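(* Let $H_0$ be the skeleton (vertex-edge graph) of the truncated tetrahedron, let $v$ be a vertex of $H_0$, and let $u,w$ be the two neighbours of $v$ that lie in a common triangle with $v$. For $s\geq 0$, let $H_s$ be the plane graph obtained from $H_0$ by subdividing the edge $uv$ by $s$ new vertices $a_1,\ldots,a_s$ (in this order from $u$ to $v$) and the edge $wv$ by $s$ new vertices $b_1,\ldots,b_s$ (in this order from $w$ to $v$), and adding the edges $a_ib_i$ for $i=1,\ldots,s$ (equivalently, $H_s$ is obtained from $H_{s-1}$ by truncating the vertex $v$). Then for every $s\geq 0$, the $2$-connected plane graph $H_s$ and its dual graph both have a Hamiltonian cycle, but $G(L(H_s))$ does not admit a rhombic strip.
   Context: The truncated tetrahedron is the polytope obtained from a tetrahedron by truncating each vertex to a triangle; its skeleton is a cubic planar graph on 12 vertices consisting of four vertex-disjoint triangles, any two joined by one edge. For a plane graph $H$, $L(H)$ is the graded poset on the vertices (rank $0$), edges (rank $1$) and faces including the outer face (rank $2$) of $H$, together with a minimum $\emptyset$ (rank $-1$) and maximum $H$ (rank $3$), ordered by inclusion; $G(L(H))$ is its cover graph. The cylinder is the quotient of $\mathbb{R}^2$ by $(x,y)\sim(x+1,y)$. For a graded poset with rank function $\rho$, a rhombic strip is a spanning subgraph of its cover graph embedded on the cylinder such that each vertex $x$ lies at height $\rho(x)$, edges are straight segments without crossings, and every face is a $4$-cycle $(a,b,c,d)$ with $\rho(a)=\rho(c)=r$, $\rho(b)=r-1$, $\rho(d)=r+1$ for some $r$. *)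

theory Defs
  imports
    "HOL-Analysis.Analysis"
    "HOL-Combinatorics.Orbits"
    "Graph_Theory.Graph_Theory"
begin

section \<open>Hamiltonian and 2-connected graphs\<close>

text \<open>
  Undirected graphs are symmetric digraphs.  In this representation \<open>x, y, x\<close>, using the two
  arcs of a single edge, is a cycle as well, hence the lower bound on the length.
\<close>

definition hamiltonian :: "('a, 'b) pre_digraph \<Rightarrow> bool" where
  "hamiltonian G \<longleftrightarrow>
     (\<exists>p. pre_digraph.cycle G p \<and> 3 \<le> length p \<and> tail G ` set p = verts G)"

definition two_connected :: "('a, 'b) pre_digraph \<Rightarrow> bool" where
  "two_connected G \<longleftrightarrow>
     3 \<le> card (verts G) \<and> Digraph_Component.connected G \<and>
     (\<forall>x\<in>verts G. Digraph_Component.connected (pre_digraph.del_vert G x))"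


section \<open>Plane graphs\<close>

text \<open>
  A plane graph is given combinatorially by a finite simple graph \<open>G\<close> and a rotation system:
  \<open>rot x\<close> permutes the neighbours of \<open>x\<close> in their cyclic (say, counterclockwise) order
  around \<open>x\<close>.  A face is the set of arcs met by a walk along its boundary, which after the arc
  \<open>(x, y)\<close> continues with the neighbour of \<open>y\<close> following \<open>x\<close>.  The outer face is one of these
  orbits.  Euler's formula says that the surface obtained by gluing in the faces is the sphere.
\<close>

type_synonym 'v rotation = "'v \<Rightarrow> 'v \<Rightarrow> 'v"

definition face_step :: "'v rotation \<Rightarrow> 'v \<times> 'v \<Rightarrow> 'v \<times> 'v" where
  "face_step rot = (\<lambda>(x, y). (y, rot y x))"

definition faces :: "'v pair_pre_digraph \<Rightarrow> 'v rotation \<Rightarrow> ('v \<times> 'v) set set" where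
  "faces G rot = orbit (face_step rot) ` parcs G"

definition edges :: "'v pair_pre_digraph \<Rightarrow> 'v set set" where
  "edges G = {{x, y} |x y. (x, y) \<in> parcs G}"

definition plane_graph :: "'v pair_pre_digraph \<Rightarrow> 'v rotation \<Rightarrow> bool" where
  "plane_graph G rot \<longleftrightarrow>
     pair_graph G \<and> Digraph_Component.connected G \<and>
     (\<forall>x\<in>pverts G. cyclic_on (rot x) {y. (x, y) \<in> parcs G}) \<and>
     int (card (pverts G)) - int (card (edges G)) + int (card (faces G rot)) = 2"

text \<open>
  The dual (multi)graph: every arc of \<open>G\<close> is an arc from the face containing it to the face
  containing the reversed arc.
\<close>

definition dual_graph ::
    "'v pair_pre_digraph \<Rightarrow> 'v rotation \<Rightarrow> (('v \<times> 'v) set, 'v \<times> 'v) pre_digraph" where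
  "dual_graph G rot =
     \<lparr>verts = faces G rot, arcs = parcs G,
      tail = orbit (face_step rot), head = (\<lambda>(x, y). orbit (face_step rot) (y, x))\<rparr>"


section \<open>The face lattice of a plane graph\<close>

datatype 'v face_elem =
  Bottom | Vertex 'v | Edge "'v set" | Face "('v \<times> 'v) set" | Whole

fun face_rank :: "'v face_elem \<Rightarrow> int" where
  "face_rank Bottom = -1"
| "face_rank (Vertex x) = 0"
| "face_rank (Edge e) = 1"
| "face_rank (Face f) = 2"
| "face_rank Whole = 3"

fun face_le :: "'v face_elem \<Rightarrow> 'v face_elem \<Rightarrow> bool" where
  "face_le Bottom q \<longleftrightarrow> True"
| "face_le p Whole \<longleftrightarrow> True"
| "face_le (Vertex x) (Edge e) \<longleftrightarrow> x \<in> e"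
| "face_le (Vertex x) (Face f) \<longleftrightarrow> (\<exists>y. (x, y) \<in> f)"
| "face_le (Edge e) (Face f) \<longleftrightarrow> (\<exists>x y. e = {x, y} \<and> (x, y) \<in> f)"
| "face_le p q \<longleftrightarrow> p = q"

definition face_elems :: "'v pair_pre_digraph \<Rightarrow> 'v rotation \<Rightarrow> 'v face_elem set" where
  "face_elems G rot =
     {Bottom, Whole} \<union> Vertex ` pverts G \<union> Edge ` edges G \<union> Face ` faces G rot"

definition face_lattice :: "'v pair_pre_digraph \<Rightarrow> 'v rotation \<Rightarrow> 'v face_elem rel" where
  "face_lattice G rot =
     {(p, q). p \<in> face_elems G rot \<and> q \<in> face_elems G rot \<and> face_le p q}"


section \<open>Rhombic strips\<close>

text \<open>The edges of the cover graph, directed upwards.\<close>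

definition covers :: "'p rel \<Rightarrow> 'p rel" where
  "covers r =
     {(x, y) \<in> r. x \<noteq> y \<and> \<not> (\<exists>z. z \<noteq> x \<and> z \<noteq> y \<and> (x, z) \<in> r \<and> (z, y) \<in> r)}"

definition graded_by :: "'p rel \<Rightarrow> ('p \<Rightarrow> int) \<Rightarrow> bool" where
  "graded_by r \<rho> \<longleftrightarrow>
     Partial_order r \<and> (\<forall>(x, y)\<in>r. x \<noteq> y \<longrightarrow> \<rho> x < \<rho> y) \<and>
     (\<forall>(x, y)\<in>covers r. \<rho> y = \<rho> x + 1)"

text \<open>The face lattice of a plane graph is indeed a graded poset.\<close>

lemma face_lattice_iff:
  "(p, q) \<in> face_lattice G rot \<longleftrightarrow>
     p \<in> face_elems G rot \<and> q \<in> face_elems G rot \<and> face_le p q"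
  by (simp add: face_lattice_def)

lemma face_le_refl: "face_le p p"
  by (cases p) auto

lemma Field_face_lattice: "Field (face_lattice G rot) = face_elems G rot"
  by (auto simp: Field_def face_lattice_def face_le_refl)

lemma face_le_rank: "face_le p q \<Longrightarrow> p \<noteq> q \<Longrightarrow> face_rank p < face_rank q"
  by (cases p; cases q) auto

lemma face_le_trans:
  assumes "face_le p q" "face_le q r" "r \<in> face_elems G rot"
  shows "face_le p r"
proof -
  have step: "face_step rot d \<in> f" if "Face f \<in> face_elems G rot" "d \<in> f" for d f
    using that by (auto simp: face_elems_def faces_def intro: orbit.step)
  show ?thesis
  proof (cases "p = q \<or> q = r \<or> p = Bottom \<or> r = Whole")
    case True
    then show ?thesis
      using assms by (cases p) auto
  next
    case False
    then obtain x e f where eq: "p = Vertex x" "q = Edge e" "r = Face f"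
      using assms by (cases p; cases q; cases r) auto
    then obtain a b where ab: "e = {a, b}" "(a, b) \<in> f"
      using assms by auto
    have "face_step rot (a, b) \<in> f"
      using step assms ab eq by blast
    then show ?thesis
      using assms eq ab by (auto simp: face_step_def)
  qed
qed

lemma graded_face_lattice:
  assumes "plane_graph G rot"
  shows "graded_by (face_lattice G rot) face_rank"
proof -
  let ?L = "face_lattice G rot"
  interpret pair_graph G
    using assms by (simp add: plane_graph_def)
  have cyc: "cyclic_on (rot x) {y. (x, y) \<in> parcs G}" if "x \<in> pverts G" for x
    using assms that by (simp add: plane_graph_def)
  have symG: "(y, x) \<in> parcs G" if "(x, y) \<in> parcs G" for x y
    using that pair_sym_arcs by (auto simp: symmetric_def sym_def)
  have wf: "x \<in> pverts G" "y \<in> pverts G" if "(x, y) \<in> parcs G" for x y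
    using that arc_fst_in_verts arc_snd_in_verts by force+
  have nonempty: "pverts G \<noteq> {}"
    using assms
    by (auto simp: plane_graph_def connected_def strongly_connected_def mk_symmetric_def)
  have rot_arc: "(x, rot x y) \<in> parcs G" if "(x, y) \<in> parcs G" for x y
    using cyclic_on_inI[OF cyc, of x y] that wf by auto
  have degree: "\<exists>y. (x, y) \<in> parcs G" if "x \<in> pverts G" for x
    using cyc[OF that] by (auto simp: cyclic_on_def)
  have pred: "\<exists>z. (x, z) \<in> parcs G \<and> y = rot x z" if xy: "(x, y) \<in> parcs G" for x y
  proof -
    from cyc[of x] wf xy obtain s where s: "(x, s) \<in> parcs G"
      "{y. (x, y) \<in> parcs G} = orbit (rot x) s"
      by (auto simp: cyclic_on_def)
    with xy have "y \<in> orbit (rot x) s" by blast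
    then show ?thesis
      by cases (use s in auto)
  qed
  have in_orbit: "d \<in> orbit (face_step rot) d0 \<Longrightarrow> d0 \<in> parcs G \<Longrightarrow> d \<in> parcs G" for d d0
    by (induction rule: orbit.induct) (auto simp: face_step_def split: prod.splits intro: rot_arc symG)
  have face_arc: "(x, y) \<in> parcs G" if "Face f \<in> face_elems G rot" "(x, y) \<in> f" for f x y
    using that in_orbit by (auto simp: face_elems_def faces_def)
  have some_face: "\<exists>f. Face f \<in> face_elems G rot \<and> (x, y) \<in> f" if xy: "(x, y) \<in> parcs G" for x y
  proof -
    obtain z where z: "(x, z) \<in> parcs G" "y = rot x z"
      using pred[OF xy] by blast
    have "(x, y) = face_step rot (z, x)"
      using z by (simp add: face_step_def)
    then have "(x, y) \<in> orbit (face_step rot) (z, x)"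
      by (metis orbit.base)
    then show ?thesis
      using symG[OF z(1)] unfolding face_elems_def faces_def by blast
  qed
  have face_nonempty: "\<exists>x y. (x, y) \<in> f" if "Face f \<in> face_elems G rot" for f
    using that by (auto simp: face_elems_def faces_def) (metis orbit.base surj_pair)
  have mem: "Bottom \<in> face_elems G rot" "Whole \<in> face_elems G rot"
    "Vertex x \<in> face_elems G rot \<longleftrightarrow> x \<in> pverts G"
    "Edge e \<in> face_elems G rot \<longleftrightarrow> (\<exists>x y. e = {x, y} \<and> (x, y) \<in> parcs G)" for x e
    by (auto simp: face_elems_def edges_def)
  have between: "\<exists>q. face_rank q = face_rank p + 1 \<and> (p, q) \<in> ?L \<and> (q, r) \<in> ?L"
    if pr: "(p, r) \<in> ?L" and gap: "face_rank p + 1 < face_rank r" for p r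
  proof (cases p)
    case Bottom
    have "\<exists>x\<in>pverts G. face_le (Vertex x) r"
    proof (cases r)
      case (Edge e)
      then show ?thesis using pr wf by (auto simp: face_lattice_iff mem)
    next
      case (Face f)
      then obtain x y where xy: "(x, y) \<in> f"
        using face_nonempty[of f] pr by (auto simp: face_lattice_iff)
      moreover have "x \<in> pverts G"
        using pr Face xy wf(1) face_arc[of f x y] by (auto simp: face_lattice_iff)
      ultimately show ?thesis using Face by auto
    qed (use nonempty gap Bottom in auto)
    then obtain x where x: "x \<in> pverts G" "face_le (Vertex x) r" by blast
    show ?thesis
      by (rule exI[of _ "Vertex x"]) (use x pr Bottom in \<open>auto simp: face_lattice_iff mem\<close>)
  next
    case (Vertex x)
    then have x: "x \<in> pverts G"
      using pr by (auto simp: face_lattice_iff mem)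
    have "\<exists>y. (x, y) \<in> parcs G \<and> face_le (Edge {x, y}) r"
    proof (cases r)
      case (Face f)
      then show ?thesis
        using pr Vertex face_arc by (auto simp: face_lattice_iff)
    next
      case Whole
      then show ?thesis using degree[OF x] by auto
    qed (use gap Vertex in auto)
    then obtain y where y: "(x, y) \<in> parcs G" "face_le (Edge {x, y}) r" by blast
    show ?thesis
      by (rule exI[of _ "Edge {x, y}"])
        (use x y pr Vertex in \<open>auto simp: face_lattice_iff mem\<close>)
  next
    case (Edge e)
    then have r: "r = Whole"
      using gap by (cases r) auto
    obtain x y where e: "e = {x, y}" "(x, y) \<in> parcs G"
      using pr Edge by (auto simp: face_lattice_iff mem)
    then obtain f where f: "Face f \<in> face_elems G rot" "(x, y) \<in> f"
      using some_face by blast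
    show ?thesis
      by (rule exI[of _ "Face f"]) (use r e f pr Edge in \<open>auto simp: face_lattice_iff\<close>)
  next
    case (Face f)
    then show ?thesis using gap by (cases r) auto
  next
    case Whole
    then show ?thesis using gap by (cases r) auto
  qed
  have "face_rank y = face_rank x + 1" if xy: "(x, y) \<in> covers ?L" for x y
  proof (rule ccontr)
    assume neq: "face_rank y \<noteq> face_rank x + 1"
    have L: "(x, y) \<in> ?L" "x \<noteq> y"
      using xy by (auto simp: covers_def)
    then have "face_rank x < face_rank y"
      using face_le_rank by (auto simp: face_lattice_iff)
    with neq have "face_rank x + 1 < face_rank y" by simp
    from between[OF L(1) this] obtain q where
      q: "face_rank q = face_rank x + 1" "(x, q) \<in> ?L" "(q, y) \<in> ?L" by blast
    with neq have "q \<noteq> x" "q \<noteq> y" by auto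
    with q xy show False by (auto simp: covers_def)
  qed
  moreover have "face_rank x < face_rank y" if "(x, y) \<in> ?L" "x \<noteq> y" for x y
    using that face_le_rank by (auto simp: face_lattice_iff)
  moreover have "Partial_order ?L"
  proof -
    have "antisym ?L"
      by (rule antisymI) (metis face_le_rank face_lattice_iff less_asym)
    moreover have "trans ?L"
      by (rule transI) (metis face_le_trans face_lattice_iff)
    moreover have "refl_on (Field ?L) ?L"
      by (auto simp: refl_on_def Field_face_lattice face_le_refl face_lattice_iff)
    moreover have "?L \<subseteq> Field ?L \<times> Field ?L"
      by (auto simp: Field_def)
    ultimately show ?thesis
      by (auto simp: partial_order_on_def preorder_on_def)
  qed
  ultimately show ?thesis
    by (auto simp: graded_by_def)
qed

text \<open>
  The quotient of the plane by \<open>(x, y) \<sim> (x + 1, y)\<close> is realised as the product of the unit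
  circle and the real line, with quotient map \<open>cyl\<close>.
\<close>

definition cyl :: "real \<times> real \<Rightarrow> complex \<times> real" where
  "cyl = (\<lambda>(x, y). (cis (2 * pi * x), y))"

definition cylinder :: "(complex \<times> real) set" where
  "cylinder = sphere 0 1 \<times> UNIV"

lemma cyl_eq_iff: "cyl p = cyl q \<longleftrightarrow> snd p = snd q \<and> fst p - fst q \<in> \<int>"
proof -
  have "cis (2 * pi * a) = cis (2 * pi * b) \<longleftrightarrow> a - b \<in> \<int>" for a b :: real
  proof -
    have "cis (2 * pi * a) = cis (2 * pi * b) \<longleftrightarrow>
        (\<exists>n::int. 2 * pi * a = 2 * pi * b + 2 * pi * of_int n)"
      using sin_cos_eq_iff[of "2 * pi * a" "2 * pi * b"] by (auto simp: complex_eq_iff)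
    also have "\<dots> \<longleftrightarrow> (\<exists>n::int. (2 * pi) * a = (2 * pi) * (b + of_int n))"
      by (simp add: distrib_left)
    also have "\<dots> \<longleftrightarrow> (\<exists>n::int. a = b + of_int n)"
      by (simp only: mult_cancel_left) simp
    also have "\<dots> \<longleftrightarrow> a - b \<in> \<int>"
      by (auto simp: Ints_def image_iff algebra_simps)
    finally show ?thesis .
  qed
  then show ?thesis
    by (cases p; cases q) (auto simp: cyl_def)
qed

lemma range_cyl: "range cyl = cylinder"
proof -
  have "\<exists>x. z = cis (2 * pi * x)" if "norm z = 1" for z :: complex
  proof -
    have "sgn z = z" "z \<noteq> 0"
      using that by (auto simp: sgn_eq)
    then have "z = cis (2 * pi * (Arg z / (2 * pi)))"
      using cis_Arg[of z] by simp
    then show ?thesis ..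
  qed
  then show ?thesis
    by (auto simp: cyl_def cylinder_def image_iff split: prod.splits)
qed

definition straight_segment ::
    "complex \<times> real \<Rightarrow> complex \<times> real \<Rightarrow> (complex \<times> real) set \<Rightarrow> bool" where
  "straight_segment P Q S \<longleftrightarrow>
     (\<exists>p q. cyl p = P \<and> cyl q = Q \<and> S = cyl ` closed_segment p q)"

text \<open>
  \<open>E\<close> is the arc set of a spanning subgraph of the cover graph, \<open>pos\<close> and \<open>seg\<close> are the
  positions of its vertices and edges.  The faces include the two unbounded ones at the ends of
  the cylinder; the 4-cycle bounding such a face winds around the cylinder.
\<close>

definition rhombic_strip ::
    "'p rel \<Rightarrow> ('p \<Rightarrow> int) \<Rightarrow> 'p rel \<Rightarrow>
     ('p \<Rightarrow> complex \<times> real) \<Rightarrow> ('p \<times> 'p \<Rightarrow> (complex \<times> real) set) \<Rightarrow> bool" where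
  "rhombic_strip r \<rho> E pos seg \<longleftrightarrow>
     E \<subseteq> covers r \<and>
     (\<forall>x\<in>Field r. pos x \<in> cylinder \<and> snd (pos x) = of_int (\<rho> x)) \<and>
     inj_on pos (Field r) \<and>
     (\<forall>(x, y)\<in>E. straight_segment (pos x) (pos y) (seg (x, y))) \<and>
     (\<forall>e\<in>E. \<forall>e'\<in>E. e \<noteq> e' \<longrightarrow>
        seg e \<inter> seg e' \<subseteq> pos ` ({fst e, snd e} \<inter> {fst e', snd e'})) \<and>
     (\<forall>F\<in>components (cylinder - (pos ` Field r \<union> \<Union> (seg ` E))).
        \<exists>a b c d k. a \<noteq> c \<and> {(b, a), (b, c), (a, d), (c, d)} \<subseteq> E \<and>
          \<rho> a = k \<and> \<rho> c = k \<and> \<rho> b = k - 1 \<and> \<rho> d = k + 1 \<and>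
          (top_of_set cylinder) frontier_of F =
            seg (b, a) \<union> seg (b, c) \<union> seg (a, d) \<union> seg (c, d))"

definition admits_rhombic_strip :: "'p rel \<Rightarrow> ('p \<Rightarrow> int) \<Rightarrow> bool" where
  "admits_rhombic_strip r \<rho> \<longleftrightarrow> (\<exists>E pos seg. rhombic_strip r \<rho> E pos seg)"


section \<open>The truncated tetrahedron\<close>

text \<open>
  The tetrahedron has the vertices \<open>0, 1, 2, 3\<close>; \<open>tetra_rot i\<close> is the rotation of the three other
  vertices around \<open>i\<close>, so \<open>j, tetra_rot i j, tetra_rot i (tetra_rot i j)\<close> is their cyclic order
  (the entry \<open>0\<close> at \<open>i = j\<close> is a dummy).
  The vertex \<open>(i, j)\<close> of the truncated tetrahedron lies next to \<open>i\<close> on the edge \<open>ij\<close>.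
\<close>

definition tetra_rot :: "nat \<Rightarrow> nat \<Rightarrow> nat" where
  "tetra_rot i j = [[0, 2, 3, 1], [3, 0, 0, 2], [1, 3, 0, 0], [2, 0, 1, 0]] ! i ! j"

definition trunc_tetra :: "(nat \<times> nat) pair_pre_digraph" where
  "trunc_tetra =
     \<lparr>pverts = {(i, j). i < 4 \<and> j < 4 \<and> i \<noteq> j},
      parcs = {((i, j), (k, l)). i < 4 \<and> j < 4 \<and> k < 4 \<and> l < 4 \<and> i \<noteq> j \<and> k \<noteq> l \<and>
                 (i = k \<and> j \<noteq> l \<or> i = l \<and> j = k)}\<rparr>"

text \<open>\<open>cyc3 p q r\<close> is the cyclic permutation \<open>p, q, r\<close>.\<close>

definition cyc3 :: "'v \<Rightarrow> 'v \<Rightarrow> 'v \<Rightarrow> 'v \<Rightarrow> 'v" where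
  "cyc3 p q r x = (if x = p then q else if x = q then r else p)"

definition trunc_tetra_rot :: "(nat \<times> nat) rotation" where
  "trunc_tetra_rot = (\<lambda>(i, j).
     cyc3 (j, i) (i, tetra_rot i j) (i, tetra_rot i (tetra_rot i j)))"


section \<open>Inserting a ladder at a triangle\<close>

text \<open>
  \<open>uv\<close> and \<open>wv\<close> are subdivided by \<open>s\<close> vertices \<open>SubU i\<close> and \<open>SubW i\<close>, \<open>1 \<le> i \<le> s\<close>.  The paths
  replacing them are \<open>ladder_u 0, \<dots>, ladder_u (s + 1)\<close> and \<open>ladder_w 0, \<dots>, ladder_w (s + 1)\<close>.
\<close>

datatype 'v ladder_vertex = Old 'v | SubU nat | SubW nat

definition ladder_u :: "'v \<Rightarrow> 'v \<Rightarrow> nat \<Rightarrow> nat \<Rightarrow> 'v ladder_vertex" where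
  "ladder_u v u s i = (if i = 0 then Old u else if i \<le> s then SubU i else Old v)"

definition ladder_w :: "'v \<Rightarrow> 'v \<Rightarrow> nat \<Rightarrow> nat \<Rightarrow> 'v ladder_vertex" where
  "ladder_w v w s i = (if i = 0 then Old w else if i \<le> s then SubW i else Old v)"

definition ladder_graph ::
    "'v \<Rightarrow> 'v \<Rightarrow> 'v \<Rightarrow> nat \<Rightarrow> 'v pair_pre_digraph \<Rightarrow> 'v ladder_vertex pair_pre_digraph" where
  "ladder_graph v u w s G =
     (let new =
        {(ladder_u v u s i, ladder_u v u s (i + 1)) |i. i \<le> s} \<union>
        {(ladder_w v w s i, ladder_w v w s (i + 1)) |i. i \<le> s} \<union>
        {(SubU i, SubW i) |i. 1 \<le> i \<and> i \<le> s}
      in \<lparr>pverts = Old ` pverts G \<union> SubU ` {1..s} \<union> SubW ` {1..s},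
          parcs =
            {(Old x, Old y) |x y. (x, y) \<in> parcs G \<and> {x, y} \<noteq> {u, v} \<and> {x, y} \<noteq> {w, v}} \<union>
            new \<union> new\<inverse>\<rparr>)"

text \<open>
  The rotation at an old vertex \<open>x\<close> is unchanged, except that its edge towards the old neighbour
  \<open>y\<close> now ends in \<open>ladder_towards \<dots> x y\<close>; \<open>ladder_origin\<close> is the inverse map.
  At the new vertices the rungs are drawn inside the triangle \<open>u, v, w\<close>; its boundary is traversed
  in the order \<open>u, v, w\<close> if \<open>w\<close> follows \<open>u\<close> in the rotation at \<open>v\<close>, and in the order
  \<open>w, v, u\<close> otherwise.
\<close>

definition ladder_towards :: "'v \<Rightarrow> 'v \<Rightarrow> 'v \<Rightarrow> nat \<Rightarrow> 'v \<Rightarrow> 'v \<Rightarrow> 'v ladder_vertex" where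
  "ladder_towards v u w s x y =
     (if (x, y) = (u, v) then ladder_u v u s 1
      else if (x, y) = (w, v) then ladder_w v w s 1
      else if (x, y) = (v, u) then ladder_u v u s s
      else if (x, y) = (v, w) then ladder_w v w s s
      else Old y)"

fun ladder_origin :: "'v \<Rightarrow> 'v \<Rightarrow> 'v \<Rightarrow> 'v \<Rightarrow> 'v ladder_vertex \<Rightarrow> 'v" where
  "ladder_origin v u w x (Old y) = y"
| "ladder_origin v u w x (SubU i) = (if x = v then u else v)"
| "ladder_origin v u w x (SubW i) = (if x = v then w else v)"

fun ladder_rot :: "'v \<Rightarrow> 'v \<Rightarrow> 'v \<Rightarrow> nat \<Rightarrow> 'v rotation \<Rightarrow> 'v ladder_vertex rotation" where
  "ladder_rot v u w s rot (Old x) z =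
     ladder_towards v u w s x (rot x (ladder_origin v u w x z))"
| "ladder_rot v u w s rot (SubU i) z =
     (if rot v u = w
      then cyc3 (ladder_u v u s (i - 1)) (SubW i) (ladder_u v u s (i + 1)) z
      else cyc3 (ladder_u v u s (i + 1)) (SubW i) (ladder_u v u s (i - 1)) z)"
| "ladder_rot v u w s rot (SubW i) z =
     (if rot v u = w
      then cyc3 (ladder_w v w s (i + 1)) (SubU i) (ladder_w v w s (i - 1)) z
      else cyc3 (ladder_w v w s (i - 1)) (SubU i) (ladder_w v w s (i + 1)) z)"

end

theory Submission
  imports Defs
begin

text \<open>
  In a rhombic strip the elements of each rank are arranged in a circle, and neighbouring elements
  \<open>a, c\<close> of rank \<open>k\<close> have a common neighbour in the strip at each of the ranks \<open>k - 1\<close> and \<open>k + 1\<close>.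
  Let \<open>C\<close> be the set of edges of \<open>H\<close> with two lower and \<open>D\<close> the set of edges with two upper neighbours in the
  strip; these are the edges of a Hamiltonian cycle of \<open>H\<close> and of its dual.  Since \<open>H\<close> is cubic, every
  edge belongs to \<open>C\<close> or \<open>D\<close>: otherwise it and the two neighbouring edges would be three edges at one
  corner of a face.  As \<open>C\<close> has at most as many elements as \<open>H\<close> has vertices, and \<open>D\<close> at most as many
  as \<open>H\<close> has faces, Euler's formula gives \<open>card (C \<inter> D) \<le> 2\<close>.  But a triangular face has two edges
  in \<open>D\<close> and at most one edge outside \<open>C\<close>, so it has an edge in \<open>C \<inter> D\<close>, and \<open>H\<close> has three disjoint
  triangles, the old ones not containing \<open>v\<close>.
\<close>

section \<open>Rhombic strips\<close>

text \<open>That \<open>C\<close> and \<open>D\<close> form Hamiltonian cycles is only motivation;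
  the argument uses inequalities. A straight edge may wind around the cylinder arbitrarily often, so
  left and right have no meaning there and a rank comes with no linear order. Two geometric facts
  carry the weight. Counting: edges lifted to the universal cover, the plane, cannot cross, and
  choosing a left neighbour becomes an injection into the adjacent rank; this bounds
  \<open>card C\<close> and \<open>card D\<close> from above. Locality: in a rank with at least
  three elements, each element has two different neighbours on its circle and shares a rhombus with
  either; this yields two edges of \<open>C\<close> at every vertex and two edges of
  \<open>D\<close> on every face. For the graphs themselves the obstacle is uniformity: there are 24
  choices of \<open>v\<close>, \<open>u\<close>, \<open>w\<close>, half of them with the opposite
  orientation, and \<open>s\<close> is arbitrary. All walks are therefore written once, in symbolic
  labels, and read backwards for the other orientation.\<close>

lemma cyl_translate: "cyl ((of_int n, 0) + p) = cyl p"
  by (simp add: cyl_eq_iff)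

lemma snd_cyl [simp]: "snd (cyl p) = snd p"
  by (simp add: cyl_def split: prod.splits)

locale strip =
  fixes r :: "'p rel" and \<rho> :: "'p \<Rightarrow> int" and E :: "'p rel"
    and pos :: "'p \<Rightarrow> complex \<times> real" and seg :: "'p \<times> 'p \<Rightarrow> (complex \<times> real) set"
  assumes strip: "rhombic_strip r \<rho> E pos seg"
    and rank_covers: "(x, y) \<in> covers r \<Longrightarrow> \<rho> y = \<rho> x + 1"
    and finite_Field: "finite (Field r)"
begin

lemma E_covers: "(x, y) \<in> E \<Longrightarrow> (x, y) \<in> covers r"
  using strip by (auto simp: rhombic_strip_def)

lemma E_rank: "(x, y) \<in> E \<Longrightarrow> \<rho> y = \<rho> x + 1"
  using E_covers rank_covers by blast

lemma E_Field: "(x, y) \<in> E \<Longrightarrow> x \<in> Field r \<and> y \<in> Field r"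
  using E_covers[of x y] by (auto simp: covers_def Field_def)

lemma snd_pos: "x \<in> Field r \<Longrightarrow> snd (pos x) = of_int (\<rho> x)"
  using strip by (auto simp: rhombic_strip_def)

lemma pos_eq_iff: "x \<in> Field r \<Longrightarrow> y \<in> Field r \<Longrightarrow> pos x = pos y \<longleftrightarrow> x = y"
  using strip by (auto simp: rhombic_strip_def inj_on_def)

lemma seg_Int_subset:
  assumes "e \<in> E" "e' \<in> E" "e \<noteq> e'"
  shows "seg e \<inter> seg e' \<subseteq> pos ` ({fst e, snd e} \<inter> {fst e', snd e'})"
proof -
  have "\<forall>e\<in>E. \<forall>e'\<in>E. e \<noteq> e' \<longrightarrow>
      seg e \<inter> seg e' \<subseteq> pos ` ({fst e, snd e} \<inter> {fst e', snd e'})"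
    using strip unfolding rhombic_strip_def by (elim conjE)
  then show ?thesis using assms by blast
qed

lemma rhombus_frontier:
  assumes "F \<in> components (cylinder - (pos ` Field r \<union> \<Union> (seg ` E)))"
  obtains a b c d k where "a \<noteq> c" "(b, a) \<in> E" "(b, c) \<in> E" "(a, d) \<in> E" "(c, d) \<in> E"
    "\<rho> a = k" "\<rho> c = k" "\<rho> b = k - 1" "\<rho> d = k + 1"
    "(top_of_set cylinder) frontier_of F = seg (b, a) \<union> seg (b, c) \<union> seg (a, d) \<union> seg (c, d)"
proof -
  have "\<exists>a b c d k. a \<noteq> c \<and> {(b, a), (b, c), (a, d), (c, d)} \<subseteq> E \<and>
      \<rho> a = k \<and> \<rho> c = k \<and> \<rho> b = k - 1 \<and> \<rho> d = k + 1 \<and>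
      (top_of_set cylinder) frontier_of F = seg (b, a) \<union> seg (b, c) \<union> seg (a, d) \<union> seg (c, d)"
    using strip assms unfolding rhombic_strip_def by (elim conjE) (erule bspec)
  then show ?thesis
    by (elim exE conjE) (rule that; simp only: insert_subset simp_thms)
qed

section \<open>Lifts of vertices and edges to the plane\<close>

lemma ex_angle:
  assumes "x \<in> Field r"
  shows "\<exists>t. pos x = cyl (t, of_int (\<rho> x))"
proof -
  have "pos x \<in> range cyl"
    using strip assms by (auto simp: rhombic_strip_def range_cyl)
  then show ?thesis
    using snd_pos[OF assms] by (auto simp: cyl_def)
qed

text \<open>A lift of the edge to the universal cover, with abscissas \<open>s\<close> and
  \<open>t\<close> at its ends. It is determined up to a common integer translation.\<close>

definition lift :: "'p \<Rightarrow> 'p \<Rightarrow> real \<Rightarrow> real \<Rightarrow> bool" where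
  "lift x y s t \<longleftrightarrow>
     pos x = cyl (s, of_int (\<rho> x)) \<and> pos y = cyl (t, of_int (\<rho> y)) \<and>
     seg (x, y) = cyl ` closed_segment (s, of_int (\<rho> x)) (t, of_int (\<rho> y))"

lemma ex_lift:
  assumes "(x, y) \<in> E"
  shows "\<exists>s t. lift x y s t"
proof -
  have "straight_segment (pos x) (pos y) (seg (x, y))"
    using strip assms by (auto simp: rhombic_strip_def)
  then obtain p q where pq: "cyl p = pos x" "cyl q = pos y" "seg (x, y) = cyl ` closed_segment p q"
    by (auto simp: straight_segment_def)
  have "snd p = of_int (\<rho> x)" "snd q = of_int (\<rho> y)"
    using snd_pos[of x] snd_pos[of y] E_Field[OF assms] pq by (metis snd_cyl)+
  then have "lift x y (fst p) (fst q)"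
    using pq by (metis lift_def prod.collapse)
  then show ?thesis by blast
qed

lemma lift_shift:
  assumes "lift x y s t"
  shows "lift x y (of_int n + s) (of_int n + t)"
proof -
  have eq: "(of_int n + c, h) = (of_int n, 0) + (c, h)" for c h :: real
    by simp
  show ?thesis
    using assms unfolding lift_def eq closed_segment_translation image_image cyl_translate
    by blast
qed

text \<open>Prescribing the abscissa at one end allows edges with a common vertex to be lifted so
  that they share its preimage, which makes their other ends comparable.\<close>

lemma lift_from:
  assumes "(x, y) \<in> E" "pos x = cyl (s, of_int (\<rho> x))"
  shows "\<exists>t. lift x y s t"
proof -
  obtain s' t' where l: "lift x y s' t'" using ex_lift assms by blast
  then have "s - s' \<in> \<int>" using assms by (auto simp: lift_def cyl_eq_iff)
  then obtain n where "s = of_int n + s'" by (auto elim!: Ints_cases simp: algebra_simps)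
  then show ?thesis using lift_shift[OF l] by blast
qed

lemma lift_to:
  assumes "(x, y) \<in> E" "pos y = cyl (t, of_int (\<rho> y))"
  shows "\<exists>s. lift x y s t"
proof -
  obtain s' t' where l: "lift x y s' t'" using ex_lift assms by blast
  then have "t - t' \<in> \<int>" using assms by (auto simp: lift_def cyl_eq_iff)
  then obtain n where "t = of_int n + t'" by (auto elim!: Ints_cases simp: algebra_simps)
  then show ?thesis using lift_shift[OF l] by blast
qed

lemma lift_point:
  assumes "lift x y s t" "(x, y) \<in> E" "0 \<le> c" "c \<le> 1"
  shows "cyl (s + c * (t - s), of_int (\<rho> x) + c) \<in> seg (x, y)"
proof -
  have "(s + c * (t - s), of_int (\<rho> x) + c)
      = (1 - c) *\<^sub>R (s, of_int (\<rho> x)) + c *\<^sub>R (t, of_int (\<rho> y))"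
    using E_rank[OF assms(2)] by (simp add: algebra_simps)
  then show ?thesis
    using assms unfolding lift_def in_segment closed_segment_def by blast
qed

text \<open>An edge rises by exactly one unit of height, so only its ends are at integer height.
  Horizontal arcs at such a height can therefore meet the strip only in vertices.\<close>

lemma seg_integer_height:
  assumes "(x, y) \<in> E" "z \<in> seg (x, y)" "snd z = of_int k"
  shows "z = pos x \<or> z = pos y"
proof -
  obtain s t where l: "lift x y s t" using ex_lift assms by blast
  then obtain c where c: "0 \<le> c" "c \<le> 1"
    "z = cyl ((1 - c) *\<^sub>R (s, of_int (\<rho> x)) + c *\<^sub>R (t, of_int (\<rho> y)))"
    using assms(2) by (auto simp: lift_def closed_segment_def)
  then have "of_int k = of_int (\<rho> x) + c"
    using assms E_rank[OF assms(1)] by (simp add: cyl_def algebra_simps)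
  then have ck: "c = of_int (k - \<rho> x)" by simp
  then have "k - \<rho> x = 0 \<or> k - \<rho> x = 1"
    using c(1,2) by linarith
  then have "c = 0 \<or> c = 1" using ck by auto
  then show ?thesis using c l by (auto simp: lift_def)
qed

text \<open>If the order were reversed at the top, the two segments would meet strictly between two
  consecutive integer heights, whereas different edges meet only in vertices. A common upper end is
  still possible, hence the weak inequality.\<close>

lemma lifts_do_not_cross:
  assumes E: "(x, y) \<in> E" "(x', y') \<in> E" "(x, y) \<noteq> (x', y')" "\<rho> x = \<rho> x'"
    and l: "lift x y s t" "lift x' y' s' t'" and "s < s'"
  shows "t \<le> t'"
proof (rule ccontr)
  assume "\<not> t \<le> t'"
  \<comment> \<open>The distance \<open>s' - s\<close> changes linearly into the negative number
    \<open>t' - t\<close>; \<open>c\<close> is the height above the lower rank at which it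
    vanishes.\<close>
  define c where "c = (s' - s) / ((s' - s) + (t - t'))"
  have c: "0 < c" "c < 1"
    using \<open>s < s'\<close> \<open>\<not> t \<le> t'\<close> by (auto simp: c_def)
  have "c * ((s' - s) + (t - t')) = s' - s"
    using \<open>s < s'\<close> \<open>\<not> t \<le> t'\<close> by (simp add: c_def)
  then have same: "s + c * (t - s) = s' + c * (t' - s')"
    by (simp add: algebra_simps)
  let ?z = "cyl (s + c * (t - s), of_int (\<rho> x) + c)"
  have "?z \<in> seg (x, y)" "?z \<in> seg (x', y')"
    using lift_point[OF l(1) E(1), of c] lift_point[OF l(2) E(2), of c] c same E(4) by auto
  then have "?z \<in> pos ` ({x, y} \<inter> {x', y'})"
    using seg_Int_subset[OF E(1,2,3)] by auto
  then obtain z where "z \<in> {x, y}" "?z = pos z" by auto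
  then have "of_int (\<rho> x) + c = of_int (\<rho> z)"
    using snd_pos[of z] E_Field[OF E(1)] by (metis insert_iff singletonD snd_conv snd_cyl)
  then have "c = of_int (\<rho> z - \<rho> x)" by simp
  then show False using c by auto
qed

section \<open>Counting elements with two lower or two upper neighbours\<close>

text \<open>
  Map every such \<open>e\<close> to the left one of two lower neighbours.  If \<open>e\<close> and \<open>e'\<close> had the same image,
  the edge to the right lower neighbour of the left one of them would cross an edge of the other.
\<close>

lemma card_peaks_le:
  assumes S: "\<And>e. e \<in> S \<Longrightarrow> \<rho> e = k + 1 \<and> (\<exists>x y. x \<noteq> y \<and> (x, e) \<in> E \<and> (y, e) \<in> E)"
  shows "card S \<le> card {x \<in> Field r. \<rho> x = k}"
proof -
  define left where "left e x s t \<longleftrightarrow> (x, e) \<in> E \<and> lift x e s t \<and>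
      (\<exists>y s'. (y, e) \<in> E \<and> lift y e s' t \<and> s < s')" for e x s t
  have ex: "\<exists>x s t. left e x s t" if e: "e \<in> S" for e
  proof -
    obtain x y where xy: "x \<noteq> y" "(x, e) \<in> E" "(y, e) \<in> E" using S[OF e] by blast
    obtain s t where l: "lift x e s t" using ex_lift[OF xy(2)] by blast
    then have "pos e = cyl (t, of_int (\<rho> e))" by (simp add: lift_def)
    \<comment> \<open>With both edges lifted to the same upper end, one of the two lower neighbours
      is the left one, although their points on the cylinder are not ordered.\<close>
    then obtain s' where l': "lift y e s' t" using lift_to[OF xy(3)] by blast
    have "pos x \<noteq> pos y"
      using xy(1) pos_eq_iff[of x y] E_Field[OF xy(2)] E_Field[OF xy(3)] by blast
    then have "s \<noteq> s'"
      using l l' E_rank[OF xy(2)] E_rank[OF xy(3)] by (auto simp: lift_def)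
    then have "s < s' \<or> s' < s" by linarith
    then show ?thesis using l l' xy unfolding left_def by blast
  qed
  have no: "\<not> t1 < t2"
    if l: "left e1 x s t1" "left e2 x s t2" "e1 \<noteq> e2" for e1 e2 x s t1 t2
  proof -
    from l(1) obtain y s' where y: "(y, e1) \<in> E" "lift y e1 s' t1" "s < s'"
      unfolding left_def by blast
    have x: "(x, e1) \<in> E" "(x, e2) \<in> E" "lift x e2 s t2" using l by (auto simp: left_def)
    have "\<rho> x = \<rho> y" using E_rank[OF x(1)] E_rank[OF y(1)] by simp
    then show ?thesis
      using lifts_do_not_cross[OF x(2) y(1) _ _ x(3) y(2,3)] \<open>e1 \<noteq> e2\<close> by simp
  qed
  obtain f where f: "\<And>e. e \<in> S \<Longrightarrow> \<exists>s t. left e (f e) s t"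
    using ex by metis
  have "inj_on f S"
  proof (rule inj_onI, rule ccontr)
    fix e e' assume ee: "e \<in> S" "e' \<in> S" "f e = f e'" "e \<noteq> e'"
    obtain s t where l: "left e (f e) s t" using f[OF ee(1)] by blast
    obtain s' t' where l': "left e' (f e) s' t'" using f[OF ee(2)] ee(3) by auto
    have "cyl (s, of_int (\<rho> (f e))) = cyl (s', of_int (\<rho> (f e)))"
      using l l' by (simp add: left_def lift_def)
    then have "s - s' \<in> \<int>"
      by (simp add: cyl_eq_iff)
    then obtain n where "s = of_int n + s'"
      by (auto elim!: Ints_cases simp: algebra_simps)
    \<comment> \<open>Both lifts start over the same point of the cylinder. After an integer
      translation they start at the same abscissa, and \<open>no\<close> compares their upper
      ends.\<close>
    then have l'': "left e' (f e) s (of_int n + t')"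
      using l' lift_shift[of _ _ _ _ n] unfolding left_def by (metis add_strict_left_mono)
    have "pos e \<noteq> pos e'"
      using ee pos_eq_iff[of e e'] l l' E_Field by (auto simp: left_def)
    then have "t \<noteq> of_int n + t'"
      using l l'' S[OF ee(1)] S[OF ee(2)] by (auto simp: left_def lift_def)
    then show False
      using no[OF l l'' ee(4)] no[OF l'' l] ee(4) by auto
  qed
  moreover have "f e \<in> {x \<in> Field r. \<rho> x = k}" if "e \<in> S" for e
    using f[OF that] S[OF that] E_rank[of "f e" e] E_Field[of "f e" e] by (auto simp: left_def)
  ultimately show ?thesis
    using finite_Field by (intro card_inj_on_le) auto
qed

text \<open>\<open>card_peaks_le\<close> upside down: each element goes to the left one of two upper
  neighbours. If two elements had the same image, the edge from the left one of them to its right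
  upper neighbour would cross the edge from the other to the common image.\<close>

lemma card_valleys_le:
  assumes S: "\<And>e. e \<in> S \<Longrightarrow> \<rho> e = k \<and> (\<exists>x y. x \<noteq> y \<and> (e, x) \<in> E \<and> (e, y) \<in> E)"
  shows "card S \<le> card {x \<in> Field r. \<rho> x = k + 1}"
proof -
  define left where "left e x s t \<longleftrightarrow> (e, x) \<in> E \<and> lift e x s t \<and>
      (\<exists>y t'. (e, y) \<in> E \<and> lift e y s t' \<and> t < t')" for e x s t
  have ex: "\<exists>x s t. left e x s t" if e: "e \<in> S" for e
  proof -
    obtain x y where xy: "x \<noteq> y" "(e, x) \<in> E" "(e, y) \<in> E" using S[OF e] by blast
    obtain s t where l: "lift e x s t" using ex_lift[OF xy(2)] by blast
    then have "pos e = cyl (s, of_int (\<rho> e))" by (simp add: lift_def)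
    then obtain t' where l': "lift e y s t'" using lift_from[OF xy(3)] by blast
    have "pos x \<noteq> pos y"
      using xy(1) pos_eq_iff[of x y] E_Field[OF xy(2)] E_Field[OF xy(3)] by blast
    then have "t \<noteq> t'"
      using l l' E_rank[OF xy(2)] E_rank[OF xy(3)] by (auto simp: lift_def)
    then have "t < t' \<or> t' < t" by linarith
    then show ?thesis using l l' xy unfolding left_def by blast
  qed
  have no: "\<not> s1 < s2"
    if l: "left e1 x s1 t" "left e2 x s2 t" "e1 \<noteq> e2" for e1 e2 x s1 s2 t
  proof -
    from l(1) obtain y t' where y: "(e1, y) \<in> E" "lift e1 y s1 t'" "t < t'"
      unfolding left_def by blast
    have x: "(e1, x) \<in> E" "(e2, x) \<in> E" "lift e2 x s2 t" using l by (auto simp: left_def)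
    have "\<rho> e1 = \<rho> e2" using E_rank[OF x(1)] E_rank[OF x(2)] by simp
    then show ?thesis
      using lifts_do_not_cross[OF y(1) x(2) _ _ y(2) x(3)] \<open>e1 \<noteq> e2\<close> y(3) by auto
  qed
  obtain f where f: "\<And>e. e \<in> S \<Longrightarrow> \<exists>s t. left e (f e) s t"
    using ex by metis
  have "inj_on f S"
  proof (rule inj_onI, rule ccontr)
    fix e e' assume ee: "e \<in> S" "e' \<in> S" "f e = f e'" "e \<noteq> e'"
    obtain s t where l: "left e (f e) s t" using f[OF ee(1)] by blast
    obtain s' t' where l': "left e' (f e) s' t'" using f[OF ee(2)] ee(3) by auto
    have "cyl (t, of_int (\<rho> (f e))) = cyl (t', of_int (\<rho> (f e)))"
      using l l' by (simp add: left_def lift_def)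
    then have "t - t' \<in> \<int>"
      by (simp add: cyl_eq_iff)
    then obtain n where "t = of_int n + t'"
      by (auto elim!: Ints_cases simp: algebra_simps)
    then have l'': "left e' (f e) (of_int n + s') t"
      using l' lift_shift[of _ _ _ _ n] unfolding left_def by (metis add_strict_left_mono)
    have "pos e \<noteq> pos e'"
      using ee pos_eq_iff[of e e'] l l' E_Field by (auto simp: left_def)
    then have "s \<noteq> of_int n + s'"
      using l l'' S[OF ee(1)] S[OF ee(2)] by (auto simp: left_def lift_def)
    then show False
      using no[OF l l'' ee(4)] no[OF l'' l] ee(4) by auto
  qed
  moreover have "f e \<in> {x \<in> Field r. \<rho> x = k + 1}" if "e \<in> S" for e
    using f[OF that] S[OF that] E_rank[of e "f e"] E_Field[of e "f e"] by (auto simp: left_def)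
  ultimately show ?thesis
    using finite_Field by (intro card_inj_on_le) auto
qed

section \<open>Neighbours on the circle of a rank\<close>

definition consecutive :: "'p \<Rightarrow> 'p \<Rightarrow> bool" where
  "consecutive a c \<longleftrightarrow> (\<exists>b d. (b, a) \<in> E \<and> (b, c) \<in> E \<and> (a, d) \<in> E \<and> (c, d) \<in> E)"

text \<open>
  The open arc between neighbouring points at integer height lies in one region.  The frontier of
  this region contains both ends of the arc, and \<open>a, c\<close> are the only corners of a rhombus
  \<open>a, b, c, d\<close> at equal height.
\<close>

lemma consecutive_if_gap:
  assumes x: "x \<in> Field r" "\<rho> x = k" "pos x = cyl (p, of_int k)"
    and y: "y \<in> Field r" "\<rho> y = k" "pos y = cyl (q, of_int k)"
    and "x \<noteq> y" "p < q"
    and gap: "\<And>z t. z \<in> Field r \<Longrightarrow> \<rho> z = k \<Longrightarrow> p < t \<Longrightarrow> t < q \<Longrightarrow> pos z \<noteq> cyl (t, of_int k)"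
  shows "consecutive x y"
proof -
  let ?S = "pos ` Field r \<union> \<Union> (seg ` E)"
  let ?arc = "(\<lambda>t. cyl (t, of_int k)) ` {p<..<q}"
  let ?C = "connected_component_set (cylinder - ?S) (cyl ((p + q) / 2, of_int k))"
  have cont: "continuous_on A (\<lambda>t. cyl (t, of_int k))" for A
    unfolding cyl_def split by (intro continuous_intros)
  have disj: "cyl (t, of_int k) \<notin> ?S" if t: "p < t" "t < q" for t
  proof
    assume "cyl (t, of_int k) \<in> ?S"
    moreover have "cyl (t, of_int k) \<in> pos ` Field r" if e: "(a, b) \<in> E" "cyl (t, of_int k) \<in> seg (a, b)" for a b
      using seg_integer_height[OF e, of k] E_Field[OF e(1)] by auto
    ultimately obtain z where z: "z \<in> Field r" "cyl (t, of_int k) = pos z"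
      by auto
    then have "of_int (\<rho> z) = real_of_int k" using snd_pos[OF z(1)] by (metis snd_conv snd_cyl)
    then show False using gap[OF z(1) _ t] z by simp
  qed
  have "Topological_Spaces.connected ?arc"
    using cont by (intro connected_continuous_image) auto
  moreover have "?arc \<subseteq> cylinder - ?S"
  proof
    fix z assume "z \<in> ?arc"
    then obtain t where "p < t" "t < q" "z = cyl (t, of_int k)" by auto
    moreover have "z \<in> cylinder" using calculation(3) range_cyl by (metis rangeI)
    ultimately show "z \<in> cylinder - ?S" using disj[of t] by simp
  qed
  moreover have mid: "cyl ((p + q) / 2, of_int k) \<in> ?arc"
    using \<open>p < q\<close> by auto
  ultimately have arc: "?arc \<subseteq> ?C"
    by (intro connected_component_maximal) auto
  have "?C \<in> components (cylinder - ?S)"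
    unfolding components_def using \<open>?arc \<subseteq> cylinder - ?S\<close> mid by blast
  from rhombus_frontier[OF this] obtain a b c d j where rh: "a \<noteq> c" "(b, a) \<in> E" "(b, c) \<in> E" "(a, d) \<in> E" "(c, d) \<in> E"
    "\<rho> a = j" "\<rho> c = j" "\<rho> b = j - 1" "\<rho> d = j + 1"
    "(top_of_set cylinder) frontier_of ?C =
       seg (b, a) \<union> seg (b, c) \<union> seg (a, d) \<union> seg (c, d)"
    .
  \<comment> \<open>Vertices are removed from the cylinder, so \<open>z\<close> is not in the
    region; as a limit of points of the arc it is on the frontier.\<close>
  have frontier: "z \<in> (top_of_set cylinder) frontier_of ?C" if "z \<in> closure ?arc" "z \<in> pos ` Field r" for z
  proof -
    have "z \<in> cylinder" using that strip by (auto simp: rhombic_strip_def)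
    moreover have "z \<in> closure ?C" using that(1) closure_mono[OF arc] by blast
    moreover have "?C \<subseteq> cylinder" "z \<notin> ?C"
      using connected_component_subset[of "cylinder - ?S"] that(2) by blast+
    ultimately show ?thesis
      using interior_of_subset[of "top_of_set cylinder" ?C]
      by (auto simp: frontier_of_def closure_of_subtopology inf.absorb2)
  qed
  have "(\<lambda>t. cyl (t, of_int k)) ` closure {p<..<q} \<subseteq> closure ?arc"
    by (rule image_closure_subset[OF cont]) (auto simp: closure_subset)
  then have cl: "pos x \<in> closure ?arc" "pos y \<in> closure ?arc"
    using \<open>p < q\<close> x(3) y(3) by (auto simp: closure_greaterThanLessThan)
  have fr: "pos x \<in> (top_of_set cylinder) frontier_of ?C" "pos y \<in> (top_of_set cylinder) frontier_of ?C"
    using frontier[OF cl(1) imageI[OF x(1)]] frontier[OF cl(2) imageI[OF y(1)]] .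
  have corner: "z \<in> {a, b, c, d}" if z: "z \<in> {x, y}" for z
  proof -
    have zk: "z \<in> Field r" "\<rho> z = k" using z x y by auto
    have "pos z \<in> seg (b, a) \<union> seg (b, c) \<union> seg (a, d) \<union> seg (c, d)"
      using fr z rh(10) by auto
    then have "pos z \<in> {pos a, pos b, pos c, pos d}"
      using seg_integer_height[of _ _ "pos z"] snd_pos[OF zk(1)] rh by blast
    then show ?thesis
      using pos_eq_iff[OF zk(1)] rh E_Field by blast
  qed
  have "{x, y} = {a, c}"
    using corner[of x] corner[of y] \<open>x \<noteq> y\<close> x(2) y(2) rh(6-9) by auto
  then have "x = a \<and> y = c \<or> x = c \<and> y = a"
    by (auto simp: doubleton_eq_iff)
  then show ?thesis
    using rh(2-5) unfolding consecutive_def by blast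
qed

text \<open>Measured from \<open>a\<close>, the other elements of the rank have different angles
  \<open>\<phi>\<close> in the open unit interval. The smallest and the largest angle belong to the
  neighbours of \<open>a\<close> on its two sides; these differ since at least two other elements
  exist.\<close>

lemma ex_two_consecutive:
  assumes a: "a \<in> Field r" and card: "3 \<le> card {x \<in> Field r. \<rho> x = \<rho> a}"
  obtains c c' where "c \<noteq> c'" "c \<noteq> a" "c' \<noteq> a" "\<rho> c = \<rho> a" "\<rho> c' = \<rho> a"
    "consecutive a c" "consecutive c' a"
proof -
  define X where "X = {x \<in> Field r. \<rho> x = \<rho> a} - {a}"
  obtain \<theta> where \<theta>: "\<And>x. x \<in> Field r \<Longrightarrow> pos x = cyl (\<theta> x, of_int (\<rho> x))"
    using ex_angle by metis
  define \<phi> where "\<phi> x = frac (\<theta> x - \<theta> a)" for x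
  have X: "x \<in> Field r" "\<rho> x = \<rho> a" "x \<noteq> a" if "x \<in> X" for x
    using that by (auto simp: X_def)
  have "finite X" using finite_Field by (simp add: X_def)
  have "2 \<le> card X" using a card finite_Field by (simp add: X_def)
  have pos: "pos x = cyl (\<theta> a + \<phi> x, of_int (\<rho> a))" if "x \<in> X" for x
    using \<theta>[OF X(1)[OF that]] X(2)[OF that] by (simp add: \<phi>_def cyl_eq_iff frac_def)
  have inj: "inj_on \<phi> X"
  proof (rule inj_onI)
    fix x y assume "x \<in> X" "y \<in> X" "\<phi> x = \<phi> y"
    then show "x = y" using pos[of x] pos[of y] pos_eq_iff X(1) by metis
  qed
  have \<phi>_bounds: "0 < \<phi> x" "\<phi> x < 1" if "x \<in> X" for x
  proof -
    have "\<phi> x \<noteq> 0"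
      using pos[OF that] \<theta>[OF a] pos_eq_iff[OF X(1)[OF that] a] X(3)[OF that] by auto
    then show "0 < \<phi> x" using frac_ge_0[of "\<theta> x - \<theta> a"] unfolding \<phi>_def by linarith
    show "\<phi> x < 1" unfolding \<phi>_def by (rule frac_lt_1)
  qed
  have between: "z \<in> X \<and> \<phi> z = t - \<theta> a"
    if z: "z \<in> Field r" "\<rho> z = \<rho> a" "pos z = cyl (t, of_int (\<rho> a))" "\<theta> a < t" "t < \<theta> a + 1" for z t
  proof -
    have "cyl (\<theta> z, of_int (\<rho> a)) = cyl (t, of_int (\<rho> a))" using \<theta>[OF z(1)] z(2,3) by simp
    then have "\<theta> z - t \<in> \<int>" by (simp add: cyl_eq_iff)
    then obtain n where n: "\<theta> z - t = of_int n" by (auto elim: Ints_cases)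
    then have "\<theta> z - \<theta> a = (t - \<theta> a) + of_int n" by simp
    then have \<phi>z: "\<phi> z = t - \<theta> a"
      using z(4,5) unfolding \<phi>_def by (simp add: frac_unique_iff)
    then have "z \<noteq> a" using z(4) by (auto simp: \<phi>_def)
    then show ?thesis using z(1,2) \<phi>z by (simp add: X_def)
  qed
  have "X \<noteq> {}" using \<open>2 \<le> card X\<close> by auto
  define c where "c = arg_min_on \<phi> X"
  define c' where "c' = arg_min_on (\<lambda>x. - \<phi> x) X"
  have c: "c \<in> X" "\<And>x. x \<in> X \<Longrightarrow> \<phi> c \<le> \<phi> x"
    using arg_min_if_finite[OF \<open>finite X\<close> \<open>X \<noteq> {}\<close>, of \<phi>] unfolding c_def by (auto simp: not_less)
  have c': "c' \<in> X" "\<And>x. x \<in> X \<Longrightarrow> \<phi> x \<le> \<phi> c'"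
    using arg_min_if_finite[OF \<open>finite X\<close> \<open>X \<noteq> {}\<close>, of "\<lambda>x. - \<phi> x"] unfolding c'_def by (auto simp: not_less)
  have "c \<noteq> c'"
  proof
    assume "c = c'"
    then have "x = c" if "x \<in> X" for x
      using c c' inj that by (metis antisym inj_onD)
    then have "X \<subseteq> {c}" by blast
    then have "card X \<le> 1" using card_mono[of "{c}" X] by simp
    then show False using \<open>2 \<le> card X\<close> by simp
  qed
  moreover have "consecutive a c"
  proof (rule consecutive_if_gap)
    fix z t assume "z \<in> Field r" "\<rho> z = \<rho> a" "\<theta> a < t" "t < \<theta> a + \<phi> c"
    then show "pos z \<noteq> cyl (t, of_int (\<rho> a))"
      using between[of z t] c(2)[of z] \<phi>_bounds[OF c(1)] by auto
  qed (use a \<theta> X[OF c(1)] pos[OF c(1)] \<phi>_bounds[OF c(1)] in auto)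
  moreover have "consecutive c' a"
  \<comment> \<open>The gap after the last element closes at \<open>a\<close> after a full turn, so
    \<open>a\<close> is now lifted to \<open>\<theta> a + 1\<close>.\<close>
  proof (rule consecutive_if_gap[where q = "\<theta> a + 1"])
    show "pos a = cyl (\<theta> a + 1, of_int (\<rho> a))"
      using \<theta>[OF a] by (simp add: cyl_eq_iff)
    fix z t assume "z \<in> Field r" "\<rho> z = \<rho> a" "\<theta> a + \<phi> c' < t" "t < \<theta> a + 1"
    then show "pos z \<noteq> cyl (t, of_int (\<rho> a))"
      using between[of z t] c'(2)[of z] \<phi>_bounds[OF c'(1)] by auto
  qed (use a X[OF c'(1)] pos[OF c'(1)] \<phi>_bounds[OF c'(1)] in auto)
  ultimately show ?thesis
    using that X[OF c(1)] X[OF c'(1)] by blast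
qed

end

section \<open>Plane cubic graphs with three triangles\<close>

lemma inj_on_cyclic_on:
  assumes "cyclic_on f S"
  shows "inj_on f S"
proof (rule finite_surj_inj)
  show "finite S" using assms by (rule finite_cyclic_on)
  show "S \<subseteq> f ` S"
  proof
    fix y assume "y \<in> S"
    obtain s where s: "s \<in> S" "S = orbit f s" using assms by (auto simp: cyclic_on_def)
    with \<open>y \<in> S\<close> have "y \<in> orbit f s" by simp
    then show "y \<in> f ` S" by cases (use s in auto)
  qed
qed

text \<open>\<open>orbit f a\<close> starts with \<open>f a\<close>, so the claim is that the walk
  returns. The injective image of \<open>insert a (orbit f a)\<close> lies in the orbit; by
  finiteness, inserting \<open>a\<close> has added nothing.\<close>

lemma self_in_orbit_if_inj:
  assumes "finite A" "inj_on f A" "f ` A \<subseteq> A" "a \<in> A"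
  shows "a \<in> orbit f a"
proof -
  have sub: "orbit f a \<subseteq> A"
  proof
    fix y assume "y \<in> orbit f a"
    then show "y \<in> A" by induction (use assms in auto)
  qed
  let ?S = "insert a (orbit f a)"
  have S: "finite ?S" "?S \<subseteq> A"
    using sub assms finite_subset by auto
  then have "card (f ` ?S) = card ?S"
    using assms(2) by (metis card_image inj_on_subset)
  moreover have "f ` ?S \<subseteq> orbit f a" by (auto intro: orbit.intros)
  ultimately have "card ?S \<le> card (orbit f a)"
    using S(1) by (metis card_mono finite_insert)
  then have "orbit f a = ?S"
    using S(1) by (intro card_subset_eq) (auto intro: antisym card_mono)
  then show ?thesis by blast
qed

lemma finite_edges_if_finite_parcs:
  assumes "finite (parcs G)"
  shows "finite (edges G)"
proof -
  have "edges G = (\<lambda>(x, y). {x, y}) ` parcs G" by (auto simp: edges_def)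
  then show ?thesis using assms by simp
qed

section \<open>The face permutation of a plane graph\<close>

locale plane =
  fixes G :: "'v pair_pre_digraph" and rot :: "'v rotation"
  assumes plane: "plane_graph G rot"
begin

sublocale pair_graph G
  using plane by (simp add: plane_graph_def)

lemma cyclic_rot: "x \<in> pverts G \<Longrightarrow> cyclic_on (rot x) {y. (x, y) \<in> parcs G}"
  using plane by (simp add: plane_graph_def)

lemma arc_sym: "(x, y) \<in> parcs G \<Longrightarrow> (y, x) \<in> parcs G"
  by (rule arcs_symmetric)

lemma rot_arc: "(x, y) \<in> parcs G \<Longrightarrow> (x, rot x y) \<in> parcs G"
  using cyclic_on_inI[OF cyclic_rot, of x y] in_arcsD1 by auto

lemma face_step_inj: "inj_on (face_step rot) (parcs G)"
proof (rule inj_onI, clarify)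
  fix x y x' y' assume "(x, y) \<in> parcs G" "(x', y') \<in> parcs G"
    "face_step rot (x, y) = face_step rot (x', y')"
  then show "x = x' \<and> y = y'"
    using inj_on_cyclic_on[OF cyclic_rot, of y] arc_sym in_arcsD1[of y]
    by (auto simp: face_step_def inj_on_def)
qed

lemma face_step_arcs: "face_step rot ` parcs G \<subseteq> parcs G"
  using arc_sym rot_arc by (auto simp: face_step_def)

lemma self_in_face: "d \<in> parcs G \<Longrightarrow> d \<in> orbit (face_step rot) d"
  using self_in_orbit_if_inj[OF pair_finite_arcs face_step_inj face_step_arcs] .

text \<open>Faces are cycles of a permutation of the arcs, so each arc of a face generates it. In
  particular, faces with a common arc are equal.\<close>

lemma face_eq_orbit:
  assumes "f \<in> faces G rot" "d \<in> f"
  shows "f = orbit (face_step rot) d"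
proof -
  obtain d0 where "d0 \<in> parcs G" "f = orbit (face_step rot) d0"
    using assms by (auto simp: faces_def)
  then have "cyclic_on (face_step rot) f"
    using self_in_face[of d0] by (auto simp: cyclic_on_def intro!: bexI[of _ d0])
  then show ?thesis using assms orbit_cyclic_eq3 by metis
qed

lemma face_arc:
  assumes "f \<in> faces G rot" "d \<in> f"
  shows "d \<in> parcs G"
proof -
  obtain d0 where "d0 \<in> parcs G" "f = orbit (face_step rot) d0"
    using assms by (auto simp: faces_def)
  with assms(2) have "d \<in> orbit (face_step rot) d0" by simp
  then show ?thesis
    by induction (use face_step_arcs \<open>d0 \<in> parcs G\<close> in auto)
qed

lemma face_next: "f \<in> faces G rot \<Longrightarrow> (x, y) \<in> f \<Longrightarrow> (y, rot y x) \<in> f"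
  using face_eq_orbit[of f "(x, y)"] orbit.base[of "face_step rot" "(x, y)"]
  by (simp add: face_step_def)

lemma finite_faces: "finite (faces G rot)"
  using pair_finite_arcs by (simp add: faces_def)

lemma finite_edges: "finite (edges G)"
  using pair_finite_arcs by (rule finite_edges_if_finite_parcs)

lemma edges_at:
  "{e \<in> edges G. x \<in> e} = (\<lambda>y. {x, y}) ` {y. (x, y) \<in> parcs G}"
  using arc_sym by (auto simp: edges_def)

lemma card_edges_at:
  "card {e \<in> edges G. x \<in> e} = card {y. (x, y) \<in> parcs G}"
proof -
  have "inj_on (\<lambda>y. {x, y}) {y. (x, y) \<in> parcs G}"
    by (auto simp: inj_on_def doubleton_eq_iff)
  then show ?thesis unfolding edges_at by (rule card_image)
qed

definition on_face :: "'v set \<Rightarrow> ('v \<times> 'v) set \<Rightarrow> bool" where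
  "on_face e f \<longleftrightarrow> (\<exists>x y. e = {x, y} \<and> (x, y) \<in> f)"

text \<open>An edge has two arcs and each arc lies on only one face, so two of the three faces share
  an arc.\<close>

lemma on_two_faces:
  assumes "f \<in> faces G rot" "f' \<in> faces G rot" "f'' \<in> faces G rot"
    and "on_face e f" "on_face e f'" "on_face e f''"
  shows "f = f' \<or> f = f'' \<or> f' = f''"
proof -
  obtain x y where e: "e = {x, y}" using assms(4) by (auto simp: on_face_def)
  have "(x, y) \<in> g \<or> (y, x) \<in> g" if "on_face e g" for g
    using that e by (auto simp: on_face_def doubleton_eq_iff)
  then show ?thesis
    using assms face_eq_orbit by metis
qed

text \<open>The face leaves \<open>x\<close> only once by \<open>once\<close>. It also enters
  \<open>x\<close> only once: two entering arcs have the same continuation, and the rotation at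
  \<open>x\<close> is injective. Each edge of the face at \<open>x\<close> is the entering or the
  leaving one.\<close>

lemma no_three_edges_at_corner:
  assumes f: "f \<in> faces G rot" and once: "\<And>y z. (x, y) \<in> f \<Longrightarrow> (x, z) \<in> f \<Longrightarrow> y = z"
    and "on_face e f" "on_face e' f" "on_face e'' f" "x \<in> e" "x \<in> e'" "x \<in> e''"
  shows "e = e' \<or> e = e'' \<or> e' = e''"
proof -
  have "\<exists>a. e = {x, a} \<and> ((x, a) \<in> f \<or> (a, x) \<in> f)" if "on_face e f" "x \<in> e" for e
    using that by (auto simp: on_face_def)
  then obtain a a' a'' where a: "e = {x, a}" "(x, a) \<in> f \<or> (a, x) \<in> f"
    "e' = {x, a'}" "(x, a') \<in> f \<or> (a', x) \<in> f"
    "e'' = {x, a''}" "(x, a'') \<in> f \<or> (a'', x) \<in> f"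
    using assms(3-8) by metis
  have "b = b'" if b: "(b, x) \<in> f" "(b', x) \<in> f" for b b'
  proof -
    have "(x, b) \<in> parcs G" "(x, b') \<in> parcs G"
      using b face_arc[OF f] arc_sym by blast+
    moreover have "rot x b = rot x b'"
      using once face_next[OF f] b by blast
    ultimately show ?thesis
      using inj_on_cyclic_on[OF cyclic_rot, of x] in_arcsD1 by (auto simp: inj_on_def)
  qed
  then show ?thesis using a once by metis
qed

end

text \<open>The hypothesis \<open>once\<close> says that the boundary of a face does not revisit a
  vertex; it turns three edges shared by a vertex and a face into a contradiction. The hypothesis
  \<open>cubic\<close> supplies the edges of \<open>C\<close> in a triangle.\<close>

lemma no_rhombic_strip_if_triangles:
  fixes G :: "'v pair_pre_digraph" and rot :: "'v rotation"
  assumes plane: "plane_graph G rot"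
    and cubic: "\<And>x. x \<in> pverts G \<Longrightarrow> card {y. (x, y) \<in> parcs G} = 3"
    and once: "\<And>f x y z. f \<in> faces G rot \<Longrightarrow> (x, y) \<in> f \<Longrightarrow> (x, z) \<in> f \<Longrightarrow> y = z"
    and T: "T \<subseteq> faces G rot" "card T = 3"
    and triangle: "\<And>t. t \<in> T \<Longrightarrow> \<exists>p q r. t = {(p, q), (q, r), (r, p)}"
    and disjoint: "\<And>t t'. t \<in> T \<Longrightarrow> t' \<in> T \<Longrightarrow> t \<noteq> t' \<Longrightarrow> fst ` t \<inter> fst ` t' = {}"
  shows "\<not> admits_rhombic_strip (face_lattice G rot) face_rank"
proof
  assume "admits_rhombic_strip (face_lattice G rot) face_rank"
  then obtain E pos seg where strip: "rhombic_strip (face_lattice G rot) face_rank E pos seg"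
    by (auto simp: admits_rhombic_strip_def)
  interpret plane G rot by unfold_locales fact
  let ?L = "face_lattice G rot"
  have elems: "Field ?L = face_elems G rot" by (rule Field_face_lattice)
  interpret S: strip ?L face_rank E pos seg
  proof
    show "finite (Field ?L)"
      using finite_faces finite_edges pair_finite_verts by (simp add: elems face_elems_def)
    show "face_rank y = face_rank x + 1" if "(x, y) \<in> covers ?L" for x y
      using graded_face_lattice[OF plane] that by (auto simp: graded_by_def)
  qed (fact strip)
  have le: "face_le x y" if "(x, y) \<in> E" for x y
    using S.E_covers[OF that] by (simp add: covers_def face_lattice_iff)
  have EV: "x \<in> e" "e \<in> edges G" if "(Vertex x, Edge e) \<in> E" for x e
    using le[OF that] S.E_Field[OF that] by (auto simp: elems face_elems_def)
  have EF: "on_face e f" "f \<in> faces G rot" "e \<in> edges G" if "(Edge e, Face f) \<in> E" for e f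
    using le[OF that] S.E_Field[OF that] by (auto simp: elems face_elems_def on_face_def)
  have rank0: "face_rank a = 0 \<longleftrightarrow> (\<exists>x. a = Vertex x)"
    and rank1: "face_rank a = 1 \<longleftrightarrow> (\<exists>e. a = Edge e)"
    and rank2: "face_rank a = 2 \<longleftrightarrow> (\<exists>f. a = Face f)" for a :: "'v face_elem"
    by (cases a; simp)+
  have level0: "{a \<in> Field ?L. face_rank a = 0} = Vertex ` pverts G"
    and level1: "{a \<in> Field ?L. face_rank a = 1} = Edge ` edges G"
    and level2: "{a \<in> Field ?L. face_rank a = 2} = Face ` faces G rot"
    by (auto simp: elems face_elems_def rank0 rank1 rank2)
  have card0: "card {a \<in> Field ?L. face_rank a = 0} = card (pverts G)"
    and card1: "card {a \<in> Field ?L. face_rank a = 1} = card (edges G)"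
    and card2: "card {a \<in> Field ?L. face_rank a = 2} = card (faces G rot)"
    unfolding level0 level1 level2 by (simp_all add: card_image inj_on_def)

  define C where "C = {e. \<exists>x y. x \<noteq> y \<and> (Vertex x, Edge e) \<in> E \<and> (Vertex y, Edge e) \<in> E}"
  define D where "D = {e. \<exists>f g. f \<noteq> g \<and> (Edge e, Face f) \<in> E \<and> (Edge e, Face g) \<in> E}"
  have CD: "C \<subseteq> edges G" "D \<subseteq> edges G"
    using EV(2) EF(3) by (auto simp: C_def D_def)
  then have fin: "finite C" "finite D" using finite_edges finite_subset by auto
  have "card (Edge ` C) \<le> card {a \<in> Field ?L. face_rank a = 0}"
  proof (rule S.card_peaks_le)
    fix a assume "a \<in> Edge ` C"
    then obtain e x y where "a = Edge e" "x \<noteq> y" "(Vertex x, a) \<in> E" "(Vertex y, a) \<in> E"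
      by (auto simp: C_def)
    moreover from this have "Vertex x \<noteq> Vertex y" by simp
    ultimately show "face_rank a = 0 + 1 \<and> (\<exists>x y. x \<noteq> y \<and> (x, a) \<in> E \<and> (y, a) \<in> E)"
      by (metis add_0 face_rank.simps(3))
  qed
  then have card_C: "card C \<le> card (pverts G)"
    by (simp add: card0 card_image inj_on_def)
  have "card (Edge ` D) \<le> card {a \<in> Field ?L. face_rank a = 1 + 1}"
  proof (rule S.card_valleys_le)
    fix a assume "a \<in> Edge ` D"
    then obtain e f g where "a = Edge e" "f \<noteq> g" "(a, Face f) \<in> E" "(a, Face g) \<in> E"
      by (auto simp: D_def)
    moreover from this have "Face f \<noteq> Face g" by simp
    ultimately show "face_rank a = 1 \<and> (\<exists>x y. x \<noteq> y \<and> (a, x) \<in> E \<and> (a, y) \<in> E)"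
      by (metis face_rank.simps(3))
  qed
  then have card_D: "card D \<le> card (faces G rot)"
    by (simp add: card2 card_image inj_on_def)

  \<comment> \<open>Each rank needs three elements for \<open>ex_two_consecutive\<close>. The
    triangles provide the faces, the star of one vertex provides the vertices and edges.\<close>
  have card_faces: "3 \<le> card (faces G rot)"
    using card_mono[OF finite_faces T(1)] T(2) by simp
  obtain x0 where x0: "x0 \<in> pverts G"
    using plane by (auto simp: plane_graph_def connected_def strongly_connected_def mk_symmetric_def)
  have card_verts: "3 \<le> card (pverts G)"
    using card_mono[OF pair_finite_verts, of "{y. (x0, y) \<in> parcs G}"] cubic[OF x0] in_arcsD2 by auto
  have card_edges: "3 \<le> card (edges G)"
    using card_mono[OF finite_edges, of "{e \<in> edges G. x0 \<in> e}"] cubic[OF x0] by (simp add: card_edges_at)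

  \<comment> \<open>Otherwise the edges before and after \<open>e\<close> share with \<open>e\<close> the same vertex and the same face.\<close>
  have cover: "e \<in> C \<union> D" if e: "e \<in> edges G" for e
  proof (rule ccontr)
    assume not: "e \<notin> C \<union> D"
    have field: "Edge e \<in> Field ?L" using e by (simp add: elems face_elems_def)
    have level: "3 \<le> card {a \<in> Field ?L. face_rank a = face_rank (Edge e)}"
      using card_edges card1 by simp
    obtain c c' where c: "c \<noteq> c'" "c \<noteq> Edge e" "c' \<noteq> Edge e"
      "face_rank c = 1" "face_rank c' = 1" "S.consecutive (Edge e) c" "S.consecutive c' (Edge e)"
      by (rule S.ex_two_consecutive[OF field level]) (rule that; simp)
    then obtain e1 e2 where c_eq: "c = Edge e1" "c' = Edge e2" by (auto simp: rank1)
    have corner: "\<exists>x f. (Vertex x, Edge a) \<in> E \<and> (Vertex x, Edge b) \<in> E \<and>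
        (Edge a, Face f) \<in> E \<and> (Edge b, Face f) \<in> E" if cons: "S.consecutive (Edge a) (Edge b)" for a b
    proof -
      obtain p q where pq: "(p, Edge a) \<in> E" "(p, Edge b) \<in> E" "(Edge a, q) \<in> E" "(Edge b, q) \<in> E"
        using cons by (auto simp: S.consecutive_def)
      then have "face_rank p = 0" "face_rank q = 2"
        using S.E_rank[OF pq(1)] S.E_rank[OF pq(3)] by auto
      then show ?thesis using pq by (auto simp: rank0 rank2)
    qed
    obtain x f where 1: "(Vertex x, Edge e) \<in> E" "(Vertex x, Edge e1) \<in> E"
        "(Edge e, Face f) \<in> E" "(Edge e1, Face f) \<in> E"
      using corner c(6) c_eq by blast
    obtain x' f' where 2: "(Vertex x', Edge e) \<in> E" "(Vertex x', Edge e2) \<in> E"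
        "(Edge e, Face f') \<in> E" "(Edge e2, Face f') \<in> E"
      using corner c(7) c_eq by blast
    \<comment> \<open>Outside \<open>C\<close> and \<open>D\<close>, the edge \<open>e\<close> has
      only one lower and one upper neighbour in the strip, so the rhombi on both sides of it share
      them.\<close>
    have "x' = x" "f' = f" using not 1 2 by (auto simp: C_def D_def)
    then have "on_face e2 f" "x \<in> e2" using EF(1)[OF 2(4)] EV(1)[OF 2(2)] by simp_all
    then have "e = e1 \<or> e = e2 \<or> e1 = e2"
      using EF(1)[OF 1(3)] EF(1)[OF 1(4)] EV(1)[OF 1(1)] EV(1)[OF 1(2)] once[OF EF(2)[OF 1(3)]]
      by (intro no_three_edges_at_corner[OF EF(2)[OF 1(3)], of x])
    then show False using c c_eq by auto
  qed

  \<comment> \<open>The upper corner of a rhombus between \<open>x\<close> and a neighbour on its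
    circle is an edge in \<open>C\<close>. The two sides give different edges, since one edge cannot
    contain three vertices.\<close>
  have C_at: "\<exists>e e'. e \<noteq> e' \<and> e \<in> C \<and> e' \<in> C \<and> x \<in> e \<and> x \<in> e'" if x: "x \<in> pverts G" for x
  proof -
    have field: "Vertex x \<in> Field ?L" using x by (simp add: elems face_elems_def)
    have level: "3 \<le> card {a \<in> Field ?L. face_rank a = face_rank (Vertex x)}"
      using card_verts card0 by simp
    obtain c c' where c: "c \<noteq> c'" "c \<noteq> Vertex x" "c' \<noteq> Vertex x"
      "face_rank c = 0" "face_rank c' = 0" "S.consecutive (Vertex x) c" "S.consecutive c' (Vertex x)"
      by (rule S.ex_two_consecutive[OF field level]) (rule that; simp)
    then obtain y y' where c_eq: "c = Vertex y" "c' = Vertex y'" by (auto simp: rank0)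
    have joint: "\<exists>e. (Vertex a, Edge e) \<in> E \<and> (Vertex b, Edge e) \<in> E"
      if cons: "S.consecutive (Vertex a) (Vertex b)" for a b
    proof -
      obtain q where q: "(Vertex a, q) \<in> E" "(Vertex b, q) \<in> E"
        using cons by (auto simp: S.consecutive_def)
      then have "face_rank q = 1" using S.E_rank[OF q(1)] by simp
      then show ?thesis using q by (auto simp: rank1)
    qed
    obtain e e' where e: "(Vertex x, Edge e) \<in> E" "(Vertex y, Edge e) \<in> E"
      "(Vertex x, Edge e') \<in> E" "(Vertex y', Edge e') \<in> E"
      using joint c(6,7) c_eq by blast
    have "x \<in> e" "y \<in> e" "x \<in> e'" "y' \<in> e'" "e \<in> edges G" "e' \<in> edges G"
      using EV e by blast+
    moreover have "x \<noteq> y" "x \<noteq> y'" "y \<noteq> y'" using c c_eq by auto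
    ultimately have "e \<noteq> e'" by (auto simp: edges_def)
    moreover have "e \<in> C" "e' \<in> C"
      using e \<open>x \<noteq> y\<close> \<open>x \<noteq> y'\<close> by (auto simp: C_def)
    ultimately show ?thesis using \<open>x \<in> e\<close> \<open>x \<in> e'\<close> by blast
  qed

  \<comment> \<open>Dually, the lower corners of the rhombi on the two sides of \<open>f\<close> are
    different edges, since one edge cannot lie on three faces.\<close>
  have D_at: "\<exists>e e'. e \<noteq> e' \<and> e \<in> D \<and> e' \<in> D \<and> on_face e f \<and> on_face e' f" if f: "f \<in> faces G rot" for f
  proof -
    have field: "Face f \<in> Field ?L" using f by (simp add: elems face_elems_def)
    have level: "3 \<le> card {a \<in> Field ?L. face_rank a = face_rank (Face f)}"
      using card_faces card2 by simp
    obtain c c' where c: "c \<noteq> c'" "c \<noteq> Face f" "c' \<noteq> Face f"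
      "face_rank c = 2" "face_rank c' = 2" "S.consecutive (Face f) c" "S.consecutive c' (Face f)"
      by (rule S.ex_two_consecutive[OF field level]) (rule that; simp)
    then obtain g g' where c_eq: "c = Face g" "c' = Face g'" by (auto simp: rank2)
    have joint: "\<exists>e. (Edge e, Face a) \<in> E \<and> (Edge e, Face b) \<in> E"
      if cons: "S.consecutive (Face a) (Face b)" for a b
    proof -
      obtain q where q: "(q, Face a) \<in> E" "(q, Face b) \<in> E"
        using cons by (auto simp: S.consecutive_def)
      then have "face_rank q = 1" using S.E_rank[OF q(1)] by simp
      then show ?thesis using q by (auto simp: rank1)
    qed
    obtain e e' where e: "(Edge e, Face f) \<in> E" "(Edge e, Face g) \<in> E"
      "(Edge e', Face f) \<in> E" "(Edge e', Face g') \<in> E"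
      using joint c(6,7) c_eq by blast
    have "f \<noteq> g" "f \<noteq> g'" "g \<noteq> g'" using c c_eq by auto
    then have "e \<noteq> e'"
      using on_two_faces[OF EF(2)[OF e(1)] EF(2)[OF e(2)] EF(2)[OF e(4)]
        EF(1)[OF e(1)] EF(1)[OF e(2)]] EF(1)[OF e(4)] by blast
    moreover have "e \<in> D" "e' \<in> D"
      using e \<open>f \<noteq> g\<close> \<open>f \<noteq> g'\<close> by (auto simp: D_def)
    ultimately show ?thesis using EF(1) e by blast
  qed

  have "\<exists>e. e \<in> C \<inter> D \<and> e \<subseteq> fst ` t" if t: "t \<in> T" for t
  proof -
    obtain p q r where pqr: "t = {(p, q), (q, r), (r, p)}" using triangle[OF t] by blast
    have ft: "t \<in> faces G rot" using t T(1) by blast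
    obtain e e' where e: "e \<noteq> e'" "e \<in> D" "e' \<in> D" "on_face e t" "on_face e' t"
      using D_at[OF ft] by blast
    then have sub: "e \<subseteq> {p, q, r}" "e' \<subseteq> {p, q, r}"
      by (auto simp: on_face_def pqr)
    have "\<exists>z. z \<in> e \<and> z \<in> e'"
      using e(4,5) by (auto simp: on_face_def pqr)
    then obtain z where z: "z \<in> e" "z \<in> e'" by blast
    have "e \<in> edges G" "e' \<in> edges G" using e CD by auto
    then have "z \<in> pverts G"
      using z in_arcsD1 in_arcsD2 by (auto simp: edges_def)
    then obtain a b where ab: "a \<noteq> b" "a \<in> C" "b \<in> C" "z \<in> a" "z \<in> b" using C_at by blast
    \<comment> \<open>The edges \<open>e\<close>, \<open>e'\<close> of the triangle meet in
      \<open>z\<close>, where two edges of \<open>C\<close> end as well. If neither were in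
      \<open>C\<close>, then \<open>z\<close> would have degree at least four.\<close>
    have "e \<in> C \<or> e' \<in> C"
    proof (rule ccontr)
      assume "\<not> (e \<in> C \<or> e' \<in> C)"
      then have "e \<noteq> a" "e \<noteq> b" "e' \<noteq> a" "e' \<noteq> b" using ab by blast+
      then have "card {e, e', a, b} = 4" using ab(1) e(1) by simp
      moreover have "{e, e', a, b} \<subseteq> {e \<in> edges G. z \<in> e}"
        using ab z CD \<open>e \<in> edges G\<close> \<open>e' \<in> edges G\<close> by auto
      ultimately have "4 \<le> card {e \<in> edges G. z \<in> e}"
        using card_mono[of "{e \<in> edges G. z \<in> e}" "{e, e', a, b}"] finite_edges by simp
      then show False using cubic[OF \<open>z \<in> pverts G\<close>] by (simp add: card_edges_at)
    qed
    then show ?thesis using e sub pqr by auto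
  qed
  then obtain h where h: "\<And>t. t \<in> T \<Longrightarrow> h t \<in> C \<inter> D \<and> h t \<subseteq> fst ` t" by metis
  have "inj_on h T"
  proof (rule inj_onI, rule ccontr)
    fix t t' assume t: "t \<in> T" "t' \<in> T" "h t = h t'" "t \<noteq> t'"
    then have "h t \<subseteq> {}" using h[of t] h[of t'] disjoint[of t t'] by auto
    moreover have "h t \<in> edges G" using h[OF t(1)] CD by auto
    ultimately show False by (auto simp: edges_def)
  qed
  then have "card T \<le> card (C \<inter> D)"
    using h fin by (intro card_inj_on_le) auto
  moreover have "card C + card D = card (C \<union> D) + card (C \<inter> D)"
    using fin by (rule card_Un_Int)
  moreover have "C \<union> D = edges G" using cover CD by blast
  then have "card (C \<union> D) = card (edges G)" by simp
  moreover have "int (card (pverts G)) - int (card (edges G)) + int (card (faces G rot)) = 2"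
    using plane by (simp add: plane_graph_def)
  ultimately show False using card_C card_D T(2) by linarith
qed

section \<open>Certificates for Hamiltonian cycles and faces\<close>

lemma orbit_if_successively:
  assumes "successively (\<lambda>a b. f a = b) A" "f (last A) = hd A" "a \<in> set A"
  shows "orbit f a = set A"
proof -
  have A: "A \<noteq> []" using assms(3) by auto
  have closed: "f b \<in> set A" if b: "b \<in> set A" for b
  proof -
    obtain i where i: "i < length A" "b = A ! i" using b by (auto simp: in_set_conv_nth)
    show ?thesis
    proof (cases "Suc i < length A")
      case True
      then show ?thesis using successively_nth[OF assms(1)] i by auto
    next
      case False
      then have "i = length A - 1" using i(1) by simp
      then have "b = last A" using i A by (simp add: last_conv_nth)
      then show ?thesis using assms(2) A by simp
    qed
  qed
  \<comment> \<open>The orbit of \<open>last A\<close> is taken because it begins with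
    \<open>f (last A)\<close>, which is \<open>hd A\<close>.\<close>
  have "A ! i \<in> orbit f (last A)" if "i < length A" for i
    using that
  proof (induction i)
    case 0
    then show ?case using orbit.base[of f "last A"] assms(2) A by (simp add: hd_conv_nth)
  next
    case (Suc i)
    then have "A ! Suc i = f (A ! i)" using successively_nth[OF assms(1)] by auto
    then show ?case using Suc by (auto intro: orbit.step)
  qed
  moreover have "b \<in> orbit f (last A) \<Longrightarrow> b \<in> set A" for b
    by (induction rule: orbit.induct) (use closed A in auto)
  ultimately have "orbit f (last A) = set A"
    by (auto simp: in_set_conv_nth)
  then have "cyclic_on f (set A)"
    using A last_in_set by (auto simp: cyclic_on_def)
  then show ?thesis using assms(3) by (rule orbit_cyclic_eq3)
qed

section \<open>Connectedness and Hamiltonian cycles from vertex lists\<close>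

lemma connected_if_path:
  assumes "verts G = set p" "p \<noteq> []" "successively (\<lambda>x y. (x, y) \<in> arcs_ends G) p"
  shows "Digraph_Component.connected G"
proof -
  let ?R = "rtrancl_on (verts G) ((arcs_ends G)\<^sup>s)"
  have "sym ((arcs_ends G)\<^sup>s)" by (auto simp: symcl_def sym_def)
  then have sym: "sym ?R" by (rule rtrancl_on_sym)
  have start: "(p ! 0, p ! i) \<in> ?R" if "i < length p" for i
    using that
  proof (induction i)
    case 0
    then show ?case using assms(1) nth_mem by blast
  next
    case (Suc i)
    then have "(p ! i, p ! Suc i) \<in> (arcs_ends G)\<^sup>s"
      using successively_nth[OF assms(3)] by (auto simp: symcl_def)
    moreover have "(p ! 0, p ! i) \<in> ?R" "p ! Suc i \<in> verts G"
      using Suc assms(1) by auto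
    ultimately show ?case by (metis rtrancl_on_into_rtrancl_on)
  qed
  have "(a, b) \<in> ?R" if "a \<in> verts G" "b \<in> verts G" for a b
  proof -
    have a: "(p ! 0, a) \<in> ?R" and b: "(p ! 0, b) \<in> ?R"
      using that assms(1) start by (auto simp: in_set_conv_nth)
    show ?thesis by (rule rtrancl_on_trans[OF symD[OF sym a] b])
  qed
  then show ?thesis
    using assms(1,2) by (auto simp: connected_conv)
qed

lemma hamiltonianI:
  assumes "set p \<subseteq> arcs G" "successively (\<lambda>a b. head G a = tail G b) p"
    and "head G (last p) = tail G (hd p)" "distinct (map (tail G) p)"
    and "tail G ` set p = verts G" "3 \<le> length p"
  shows "hamiltonian G"
proof -
  interpret pre_digraph G .
  have ne: "p \<noteq> []" using assms(6) by auto
  have cas: "cas (tail G (hd q)) q (head G (last q))"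
    if "q \<noteq> []" "successively (\<lambda>a b. head G a = tail G b) q" for q
    using that by (induction q rule: induct_list012) auto
  let ?u = "tail G (hd p)"
  have "awalk ?u p ?u"
    using cas[OF ne assms(2)] assms(1,3,5) ne by (auto simp: awalk_def)
  \<comment> \<open>The vertex list of the closed walk begins and ends with \<open>?u\<close>;
    without its head it is a rotation of the list of tails.\<close>
  moreover have "distinct (tl (awalk_verts ?u p))"
    using assms(3,4) ne by (cases p) (auto simp: awalk_verts_conv)
  ultimately have "cycle p" using ne by (auto simp: cycle_def)
  then show ?thesis using assms(5,6) by (auto simp: hamiltonian_def)
qed

lemma hamiltonian_pairI:
  fixes G :: "'a pair_pre_digraph"
  assumes "successively (\<lambda>x y. (x, y) \<in> parcs G) p" "(last p, hd p) \<in> parcs G"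
    and "distinct p" "set p = pverts G" "3 \<le> length p"
  shows "hamiltonian G"
proof (rule hamiltonianI)
  let ?q = "zip p (rotate1 p)"
  have ne: "p \<noteq> []" using assms(5) by auto
  have nth: "?q ! i = (p ! i, p ! (Suc i mod length p))" if "i < length p" for i
    using that nth_rotate1[of i p] by simp
  have lst: "last p = p ! (length p - 1)" using ne by (rule last_conv_nth)
  have hd: "hd p = p ! 0" using ne by (rule hd_conv_nth)
  have "(p ! i, p ! (Suc i mod length p)) \<in> parcs G" if "i < length p" for i
  proof (cases "Suc i < length p")
    case True
    then show ?thesis using successively_nth[OF assms(1)] by simp
  next
    case False
    then have "Suc i = length p" using that by simp
    then show ?thesis using assms(2) lst hd by (metis diff_Suc_1 mod_self)
  qed
  then show "set ?q \<subseteq> arcs (with_proj G)"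
    using nth by (auto simp: in_set_conv_nth)
  have fst: "map fst ?q = p" and snd: "map snd ?q = rotate1 p" by simp_all
  show "successively (\<lambda>a b. head (with_proj G) a = tail (with_proj G) b) ?q"
    using nth by (simp add: successively_conv_nth)
  show "head (with_proj G) (last ?q) = tail (with_proj G) (hd ?q)"
    using nth[of 0] nth[of "length p - 1"] ne
    by (simp add: last_conv_nth hd_conv_nth)
  show "distinct (map (tail (with_proj G)) ?q)" "tail (with_proj G) ` set ?q = verts (with_proj G)"
    using assms(3,4) fst by (simp_all flip: set_map)
qed (use assms(5) in simp)

text \<open>Deleting \<open>x\<close> from a Hamiltonian cycle leaves a path through all other
  vertices: it starts behind \<open>x\<close> and runs around to the predecessor of
  \<open>x\<close>.\<close>

lemma two_connected_pairI:
  fixes G :: "'a pair_pre_digraph"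
  assumes "successively (\<lambda>x y. (x, y) \<in> parcs G) p" "(last p, hd p) \<in> parcs G"
    and "distinct p" "set p = pverts G" "3 \<le> length p"
  shows "two_connected G"
proof -
  have ne: "p \<noteq> []" using assms(5) by auto
  have "Digraph_Component.connected G"
    using assms(1,4) ne by (intro connected_if_path[of _ p]) auto
  moreover have "Digraph_Component.connected (pre_digraph.del_vert G x)" if x: "x \<in> pverts G" for x
  proof -
    obtain as bs where p: "p = as @ x # bs"
      using x assms(4) by (metis split_list)
    let ?q = "bs @ as"
    have path: "successively (\<lambda>x y. (x, y) \<in> parcs G) ?q"
      using assms(1,2) unfolding p
      by (cases "as = []") (auto simp: successively_append_iff successively_Cons split: if_splits)
    show ?thesis
    proof (rule connected_if_path)
      show "successively (\<lambda>a b. (a, b) \<in> arcs_ends (pre_digraph.del_vert G x)) ?q"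
      proof (rule successively_mono[OF path])
        fix a b assume "(a, b) \<in> parcs G" "a \<in> set ?q" "b \<in> set ?q"
        moreover have "x \<notin> set ?q" using assms(3) p by auto
        ultimately have "a \<noteq> x" "b \<noteq> x" by blast+
        then show "(a, b) \<in> arcs_ends (pre_digraph.del_vert G x)"
          using \<open>(a, b) \<in> parcs G\<close>
          by (force simp: arcs_ends_def arc_to_ends_def pre_digraph.del_vert_def)
      qed
      show "verts (pre_digraph.del_vert G x) = set ?q"
        using assms(3,4) by (auto simp: pre_digraph.del_vert_def p)
      show "?q \<noteq> []" using assms(5) p by auto
    qed
  qed
  moreover have "3 \<le> card (pverts G)"
    using assms(3-5) distinct_card[of p] by simp
  ultimately show ?thesis by (simp add: two_connected_def)
qed

section \<open>Counting arcs and listing faces\<close>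

lemma cyclic_on_triple:
  assumes "f a = b" "f b = c" "f c = a"
  shows "cyclic_on f {a, b, c}"
proof -
  have "orbit f c = set [a, b, c]"
    by (rule orbit_if_successively) (use assms in auto)
  then show ?thesis by (auto simp: cyclic_on_def)
qed

lemma card_edges_double:
  assumes "pair_graph G"
  shows "2 * card (edges G) = card (parcs G)"
proof -
  interpret pair_graph G by fact
  have fin: "finite (edges G)"
    using pair_finite_arcs by (rule finite_edges_if_finite_parcs)
  let ?A = "\<lambda>e. {(x, y). (x, y) \<in> parcs G \<and> e = {x, y}}"
  have A: "card (?A e) = 2" if e: "e \<in> edges G" for e
  proof -
    obtain x y where e: "e = {x, y}" "(x, y) \<in> parcs G"
      using e by (auto simp: edges_def)
    then have "?A e = {(x, y), (y, x)}" "x \<noteq> y"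
      using arcs_symmetric no_loops' by (auto simp: doubleton_eq_iff)
    then show ?thesis by simp
  qed
  have "parcs G = (\<Union>e\<in>edges G. ?A e)"
    by (auto simp: edges_def)
  also have "card \<dots> = (\<Sum>e\<in>edges G. card (?A e))"
    using fin A by (intro card_UN_disjoint) (auto simp: card_ge_0_finite)
  also have "\<dots> = 2 * card (edges G)" using A by simp
  finally show ?thesis by simp
qed

lemma card_parcs_cubic:
  assumes "pair_graph G" "\<And>x. x \<in> pverts G \<Longrightarrow> card {y. (x, y) \<in> parcs G} = 3"
  shows "card (parcs G) = 3 * card (pverts G)"
proof -
  interpret pair_graph G by fact
  have "parcs G = Sigma (pverts G) (\<lambda>x. {y. (x, y) \<in> parcs G})"
    using in_arcsD1 by auto
  moreover have "card (Sigma (pverts G) (\<lambda>x. {y. (x, y) \<in> parcs G})) =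
      (\<Sum>x\<in>pverts G. card {y. (x, y) \<in> parcs G})"
    using pair_finite_verts assms(2) by (intro card_SigmaI) (auto intro!: card_ge_0_finite)
  ultimately show ?thesis using assms(2) by simp
qed

text \<open>Finding all faces is reduced to exhibiting closed boundary walks that together use every
  arc: each walk is a full orbit, and no arc is left for another face.\<close>

lemma faces_certificate:
  assumes chain: "\<And>A. A \<in> set As \<Longrightarrow> A \<noteq> [] \<and>
      successively (\<lambda>d d'. face_step rot d = d') A \<and> face_step rot (last A) = hd A"
    and cover: "(\<Union>A\<in>set As. set A) = parcs G"
  shows orbit_certificate: "\<And>A d. A \<in> set As \<Longrightarrow> d \<in> set A \<Longrightarrow> orbit (face_step rot) d = set A"
    and faces_eq_certificate: "faces G rot = set ` set As"
proof -
  show orb: "orbit (face_step rot) d = set A" if "A \<in> set As" "d \<in> set A" for A d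
    using chain[OF that(1)] that(2) by (intro orbit_if_successively) auto
  show "faces G rot = set ` set As"
  proof
    show "faces G rot \<subseteq> set ` set As"
      using orb by (fastforce simp: faces_def simp flip: cover)
    show "set ` set As \<subseteq> faces G rot"
    proof
      fix f assume "f \<in> set ` set As"
      then obtain A where A: "A \<in> set As" "f = set A" by blast
      then have "hd A \<in> set A" using chain by auto
      then show "f \<in> faces G rot"
        unfolding faces_def using A orb[OF A(1)] cover by (intro rev_image_eqI[of "hd A"]) auto
    qed
  qed
qed

text \<open>The order of \<open>As\<close> is the dual cycle. An arc of \<open>p\<close> lies on the
  face at its own position and its reversal on the next face cyclically, so as a dual arc it joins
  the two.\<close>

lemma hamiltonian_dual_certificate:
  assumes chain: "\<And>A. A \<in> set As \<Longrightarrow> A \<noteq> [] \<and>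
      successively (\<lambda>d d'. face_step rot d = d') A \<and> face_step rot (last A) = hd A"
    and cover: "(\<Union>A\<in>set As. set A) = parcs G"
    and p: "list_all2 (\<lambda>d A. d \<in> set A) p As"
      "list_all2 (\<lambda>d A. prod.swap d \<in> set A) p (rotate1 As)"
    and "distinct (map set As)" "3 \<le> length As"
  shows "hamiltonian (dual_graph G rot)"
proof (rule hamiltonianI)
  let ?G = "dual_graph G rot"
  note orb = orbit_certificate[OF chain cover]
  have len: "length p = length As" using p(1) by (rule list_all2_lengthD)
  then have ne: "p \<noteq> []" "As \<noteq> []" using assms(6) by auto
  have tail: "tail ?G (p ! i) = set (As ! i)" if "i < length p" for i
    using that orb[of "As ! i" "p ! i"] p(1) len
    by (auto simp: dual_graph_def list_all2_conv_all_nth)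
  have head: "head ?G (p ! i) = set (As ! (Suc i mod length As))" if "i < length p" for i
  proof -
    have "prod.swap (p ! i) \<in> set (As ! (Suc i mod length As))"
      using that p(2) len by (auto simp: list_all2_conv_all_nth nth_rotate1)
    moreover have "As ! (Suc i mod length As) \<in> set As" using ne by simp
    ultimately show ?thesis
      using orb by (auto simp: dual_graph_def prod.swap_def split: prod.splits)
  qed
  have map: "map (tail ?G) p = map set As"
    using tail len by (auto simp: list_eq_iff_nth_eq)
  show "successively (\<lambda>a b. head ?G a = tail ?G b) p"
    using head tail len by (simp add: successively_conv_nth)
  show "head ?G (last p) = tail ?G (hd p)"
    using head[of "length p - 1"] tail[of 0] ne len by (simp add: last_conv_nth hd_conv_nth)
  show "distinct (map (tail ?G) p)" using map assms(5) by simp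
  show "set p \<subseteq> arcs ?G"
  proof
    fix d assume "d \<in> set p"
    then obtain i where i: "i < length p" "d = p ! i" by (auto simp: in_set_conv_nth)
    then have "d \<in> set (As ! i)" using p(1) by (simp add: list_all2_conv_all_nth)
    then show "d \<in> arcs ?G" using cover i(1) len by (auto simp: dual_graph_def)
  qed
  have "tail ?G ` set p = set ` set As" using map by (metis list.set_map)
  also have "\<dots> = verts ?G"
    using faces_certificate(2)[OF chain cover] by (simp add: dual_graph_def)
  finally show "tail ?G ` set p = verts ?G" .
  show "3 \<le> length p" using len assms(6) by simp
qed

section \<open>Ladders in the truncated tetrahedron\<close>

text \<open>Even relabellings of the tetrahedron preserve its rotation system and odd ones invert
  it. Hence one entry decides between the first table and the second, which consists of the inverse
  permutations.\<close>

lemma tetra_rot_orientation: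
  "\<forall>I\<in>{0, 1, 2, 3}. \<forall>x\<in>{0, 1, 2, 3}. \<forall>y\<in>{0, 1, 2, 3}. \<forall>z\<in>{0, 1, 2, 3}.
     distinct [I, x, y, z] \<longrightarrow> (if tetra_rot I x = y then
    tetra_rot I x = y \<and> tetra_rot I y = z \<and> tetra_rot I z = x \<and>
    tetra_rot x I = z \<and> tetra_rot x z = y \<and> tetra_rot x y = I \<and>
    tetra_rot y I = x \<and> tetra_rot y x = z \<and> tetra_rot y z = I \<and>
    tetra_rot z I = y \<and> tetra_rot z y = x \<and> tetra_rot z x = I else
    tetra_rot I y = x \<and> tetra_rot I z = y \<and> tetra_rot I x = z \<and>
    tetra_rot x z = I \<and> tetra_rot x y = z \<and> tetra_rot x I = y \<and>
    tetra_rot y x = I \<and> tetra_rot y z = x \<and> tetra_rot y I = z \<and>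
    tetra_rot z y = I \<and> tetra_rot z x = y \<and> tetra_rot z I = x)"
  by code_simp

text \<open>The triangle that receives the ladder sits at the tetrahedron corner \<open>I\<close>;
  the vertices \<open>v\<close>, \<open>u\<close>, \<open>w\<close> are \<open>(I, x)\<close>,
  \<open>(I, y)\<close>, \<open>(I, z)\<close>.\<close>

locale labelled_ladder =
  fixes I x y z s :: nat
  assumes lt: "I < 4" "x < 4" "y < 4" "z < 4"
    and neq: "I \<noteq> x" "I \<noteq> y" "I \<noteq> z" "x \<noteq> y" "x \<noteq> z" "y \<noteq> z"
begin

abbreviation U :: "nat \<Rightarrow> (nat \<times> nat) ladder_vertex" where "U \<equiv> ladder_u (I, x) (I, y) s"
abbreviation W :: "nat \<Rightarrow> (nat \<times> nat) ladder_vertex" where "W \<equiv> ladder_w (I, x) (I, z) s"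

definition H :: "(nat \<times> nat) ladder_vertex pair_pre_digraph" where
  "H = ladder_graph (I, x) (I, y) (I, z) s trunc_tetra"

definition rot :: "(nat \<times> nat) ladder_vertex rotation" where
  "rot = ladder_rot (I, x) (I, y) (I, z) s trunc_tetra_rot"

section \<open>Orientation and rotations\<close>

definition pos :: bool where "pos \<longleftrightarrow> tetra_rot I x = y"

text \<open>
  The two orientations of the triangle \<open>u, v, w\<close> are treated at once: \<open>turn p q r\<close> says that the walk
  \<open>p, q, r\<close> follows the boundary of a face, which is traversed backwards if \<open>pos\<close> fails.
\<close>

definition turn where
  "turn p q r \<longleftrightarrow> (if pos then rot q p = r else rot q r = p)"

lemmas neq' = neq neq[symmetric]

lemma less_4_iff: "n < 4 \<longleftrightarrow> n = I \<or> n = x \<or> n = y \<or> n = z"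
proof -
  have "{I, x, y, z} \<subseteq> {..<4}" "card {I, x, y, z} = 4"
    using lt neq by auto
  then have "{I, x, y, z} = {..<4}" by (intro card_subset_eq) auto
  then show ?thesis by (metis insert_iff lessThan_iff singletonD)
qed

lemma orientation: "if pos then
    tetra_rot I x = y \<and> tetra_rot I y = z \<and> tetra_rot I z = x \<and>
    tetra_rot x I = z \<and> tetra_rot x z = y \<and> tetra_rot x y = I \<and>
    tetra_rot y I = x \<and> tetra_rot y x = z \<and> tetra_rot y z = I \<and>
    tetra_rot z I = y \<and> tetra_rot z y = x \<and> tetra_rot z x = I else
    tetra_rot I y = x \<and> tetra_rot I z = y \<and> tetra_rot I x = z \<and>
    tetra_rot x z = I \<and> tetra_rot x y = z \<and> tetra_rot x I = y \<and>
    tetra_rot y x = I \<and> tetra_rot y z = x \<and> tetra_rot y I = z \<and>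
    tetra_rot z y = I \<and> tetra_rot z x = y \<and> tetra_rot z I = x"
proof -
  have four: "n \<in> {0, 1, 2, 3}" if "n < 4" for n :: nat using that by auto
  show ?thesis
    unfolding pos_def using neq
    by (intro tetra_rot_orientation[rule_format, OF four four four four] lt) simp
qed

lemma pos_eqs: "pos \<Longrightarrow> tetra_rot I x = y \<and> tetra_rot I y = z \<and> tetra_rot I z = x \<and>
    tetra_rot x I = z \<and> tetra_rot x z = y \<and> tetra_rot x y = I \<and>
    tetra_rot y I = x \<and> tetra_rot y x = z \<and> tetra_rot y z = I \<and>
    tetra_rot z I = y \<and> tetra_rot z y = x \<and> tetra_rot z x = I"
  using orientation by simp

lemma neg_eqs: "\<not> pos \<Longrightarrow> tetra_rot I y = x \<and> tetra_rot I z = y \<and> tetra_rot I x = z \<and>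
    tetra_rot x z = I \<and> tetra_rot x y = z \<and> tetra_rot x I = y \<and>
    tetra_rot y x = I \<and> tetra_rot y z = x \<and> tetra_rot y I = z \<and>
    tetra_rot z y = I \<and> tetra_rot z x = y \<and> tetra_rot z I = x"
  using orientation by simp

text \<open>\<open>rot q\<close> is the cycle \<open>a\<close>, \<open>b\<close>, \<open>c\<close>
  if \<open>pos\<close> holds and its inverse otherwise, so one triple describes both
  orientations.\<close>

definition rotates where
  "rotates q a b c \<longleftrightarrow> turn a q b \<and> turn b q c \<and> turn c q a"

text \<open>The ladder neighbours of \<open>v\<close>, \<open>u\<close>, \<open>w\<close> are given
  by index. For \<open>s = 0\<close> they become the old vertices themselves, which avoids a
  separate case.\<close>

lemma rotates_Old:
  "rotates (Old (x, I)) (Old (x, z)) (Old (x, y)) (Old (I, x)) \<and>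
   rotates (Old (x, y)) (Old (x, I)) (Old (x, z)) (Old (y, x)) \<and>
   rotates (Old (x, z)) (Old (x, y)) (Old (x, I)) (Old (z, x)) \<and>
   rotates (Old (y, I)) (Old (y, x)) (Old (y, z)) (Old (I, y)) \<and>
   rotates (Old (y, z)) (Old (y, I)) (Old (y, x)) (Old (z, y)) \<and>
   rotates (Old (y, x)) (Old (y, z)) (Old (y, I)) (Old (x, y)) \<and>
   rotates (Old (z, I)) (Old (z, y)) (Old (z, x)) (Old (I, z)) \<and>
   rotates (Old (z, x)) (Old (z, I)) (Old (z, y)) (Old (x, z)) \<and>
   rotates (Old (z, y)) (Old (z, x)) (Old (z, I)) (Old (y, z)) \<and>
   rotates (Old (I, x)) (Old (x, I)) (U s) (W s) \<and>
   rotates (Old (I, y)) (Old (y, I)) (Old (I, z)) (U (Suc 0)) \<and>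
   rotates (Old (I, z)) (Old (I, y)) (Old (z, I)) (W (Suc 0))"
proof (cases pos)
  case True
  then show ?thesis
    by (simp add: rotates_def turn_def pos_eqs rot_def trunc_tetra_rot_def cyc3_def
        ladder_towards_def neq' ladder_u_def ladder_w_def)
next
  case False
  then show ?thesis
    by (simp add: rotates_def turn_def neg_eqs rot_def trunc_tetra_rot_def cyc3_def
        ladder_towards_def neq' ladder_u_def ladder_w_def)
qed

lemma rotates_Sub:
  assumes "1 \<le> i" "i \<le> s"
  shows "rotates (SubU i) (U (i - 1)) (SubW i) (U (Suc i)) \<and>
    rotates (SubW i) (W (i - 1)) (W (Suc i)) (SubU i)"
proof (cases pos)
  case True
  then show ?thesis using assms
    by (auto simp: rotates_def turn_def pos_eqs rot_def trunc_tetra_rot_def cyc3_def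
        neq' ladder_u_def ladder_w_def)
next
  case False
  then show ?thesis using assms
    by (auto simp: rotates_def turn_def neg_eqs rot_def trunc_tetra_rot_def cyc3_def
        neq' ladder_u_def ladder_w_def)
qed

section \<open>Vertices, arcs and neighbourhoods\<close>

lemma U_simps [simp]: "U 0 = Old (I, y)" "U (Suc s) = Old (I, x)" "1 \<le> i \<Longrightarrow> i \<le> s \<Longrightarrow> U i = SubU i"
  and W_simps [simp]: "W 0 = Old (I, z)" "W (Suc s) = Old (I, x)" "1 \<le> i \<Longrightarrow> i \<le> s \<Longrightarrow> W i = SubW i"
  by (auto simp: ladder_u_def ladder_w_def)

lemma ladder_eq_iffs [simp]:
  "U i = Old (p, q) \<longleftrightarrow> p = I \<and> (i = 0 \<and> q = y \<or> s < i \<and> q = x)"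
  "W i = Old (p, q) \<longleftrightarrow> p = I \<and> (i = 0 \<and> q = z \<or> s < i \<and> q = x)"
  "Old (p, q) = U i \<longleftrightarrow> p = I \<and> (i = 0 \<and> q = y \<or> s < i \<and> q = x)"
  "Old (p, q) = W i \<longleftrightarrow> p = I \<and> (i = 0 \<and> q = z \<or> s < i \<and> q = x)"
  "i \<le> Suc s \<Longrightarrow> j \<le> Suc s \<Longrightarrow> U i = U j \<longleftrightarrow> i = j"
  "i \<le> Suc s \<Longrightarrow> j \<le> Suc s \<Longrightarrow> W i = W j \<longleftrightarrow> i = j"
  "U i = W j \<longleftrightarrow> s < i \<and> s < j"
  "W j = U i \<longleftrightarrow> s < i \<and> s < j"
  using neq by (auto simp: ladder_u_def ladder_w_def)

text \<open>The first two lines follow the rails along the outer faces; the other four go around the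
  cell between rungs \<open>i\<close> and \<open>i + 1\<close>. Those valid for \<open>i = s\<close>
  serve the last cell, the triangle at \<open>v\<close>.\<close>

lemma turn_ladder:
  "i < s \<Longrightarrow> turn (W i) (W (Suc i)) (W (Suc (Suc i)))"
  "i < s \<Longrightarrow> turn (U (Suc (Suc i))) (U (Suc i)) (U i)"
  "i \<le> s \<Longrightarrow> turn (W (Suc i)) (W i) (U i)"
  "i \<le> s \<Longrightarrow> turn (W i) (U i) (U (Suc i))"
  "i < s \<Longrightarrow> turn (U i) (U (Suc i)) (W (Suc i))"
  "i < s \<Longrightarrow> turn (U (Suc i)) (W (Suc i)) (W i)"
  using rotates_Sub[of i] rotates_Sub[of "Suc i"] rotates_Old
  by (cases i; simp add: rotates_def)+

text \<open>One arc of each edge outside the old triangle \<open>u, v, w\<close>. The edge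
  \<open>uw\<close> of this triangle is treated as rung 0 in \<open>half\<close>.\<close>

definition fixed_half where
  "fixed_half = {(Old (x, I), Old (I, x)), (Old (y, I), Old (I, y)), (Old (z, I), Old (I, z)),
      (Old (x, y), Old (y, x)), (Old (x, z), Old (z, x)), (Old (y, z), Old (z, y)),
      (Old (x, I), Old (x, y)), (Old (x, y), Old (x, z)), (Old (x, z), Old (x, I)),
      (Old (y, I), Old (y, z)), (Old (y, z), Old (y, x)), (Old (y, x), Old (y, I)),
      (Old (z, I), Old (z, x)), (Old (z, x), Old (z, y)), (Old (z, y), Old (z, I))}"

definition half where
  "half = fixed_half \<union>
    (\<lambda>i. (U i, U (Suc i))) ` {..s} \<union> (\<lambda>i. (W i, W (Suc i))) ` {..s} \<union> (\<lambda>i. (U i, W i)) ` {..s}"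

lemma pverts_H: "pverts H =
    {Old (x, I), Old (x, y), Old (x, z), Old (y, I), Old (y, x), Old (y, z),
     Old (z, I), Old (z, x), Old (z, y)} \<union> U ` {..Suc s} \<union> W ` {..Suc s}"
proof -
  have tt: "pverts trunc_tetra = {(x, I), (x, y), (x, z), (y, I), (y, x), (y, z),
     (z, I), (z, x), (z, y), (I, x), (I, y), (I, z)}"
    using neq' by (auto simp: trunc_tetra_def less_4_iff)
  have "{..Suc s} = {0, Suc s} \<union> {1..s}" by auto
  then have UW: "U ` {..Suc s} = {Old (I, y), Old (I, x)} \<union> SubU ` {1..s}"
    "W ` {..Suc s} = {Old (I, z), Old (I, x)} \<union> SubW ` {1..s}"
    by (auto simp: image_Un)
  show ?thesis
    unfolding UW by (auto simp: H_def ladder_graph_def Let_def tt)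
qed

lemma parcs_H: "parcs H = half \<union> half\<inverse>"
proof -
  define B where "B = {((I, y), (I, z)), ((x, I), (I, x)), ((y, I), (I, y)), ((z, I), (I, z)),
      ((x, y), (y, x)), ((x, z), (z, x)), ((y, z), (z, y)),
      ((x, I), (x, y)), ((x, y), (x, z)), ((x, z), (x, I)),
      ((y, I), (y, z)), ((y, z), (y, x)), ((y, x), (y, I)),
      ((z, I), (z, x)), ((z, x), (z, y)), ((z, y), (z, I))}"
  define S where "S = {(a, b). (a, b) \<in> parcs trunc_tetra \<and>
      {a, b} \<noteq> {(I, y), (I, x)} \<and> {a, b} \<noteq> {(I, z), (I, x)}}"
  have SB: "S = B \<union> B\<inverse>"
  proof -
    have "(a, b) \<in> B \<union> B\<inverse>"
      if "(a, b) \<in> parcs trunc_tetra" "{a, b} \<noteq> {(I, y), (I, x)}" "{a, b} \<noteq> {(I, z), (I, x)}" for a b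
    proof -
      obtain i j k l where ab: "a = (i, j)" "b = (k, l)" by (cases a; cases b)
      let ?N = "{I, x, y, z}"
      have N: "i \<in> ?N" "j \<in> ?N" "l \<in> ?N"
        and kl: "i \<noteq> j" "k \<noteq> l" "i = k \<and> j \<noteq> l \<or> i = l \<and> j = k"
        using that(1) ab by (auto simp: trunc_tetra_def less_4_iff)
      \<comment> \<open>\<open>long\<close> concerns the edges between two triangles,
        \<open>short\<close> those within a triangle.\<close>
      have long: "\<forall>i\<in>?N. \<forall>j\<in>?N. i \<noteq> j \<longrightarrow> ((i, j), (j, i)) \<in> B \<union> B\<inverse>
          \<or> {(i, j), (j, i)} = {(I, y), (I, x)} \<or> {(i, j), (j, i)} = {(I, z), (I, x)}"
        by (simp add: B_def neq')
      have short: "\<forall>i\<in>?N. \<forall>j\<in>?N. \<forall>l\<in>?N. i \<noteq> j \<longrightarrow> i \<noteq> l \<longrightarrow> j \<noteq> l \<longrightarrow> ((i, j), (i, l)) \<in> B \<union> B\<inverse>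
          \<or> {(i, j), (i, l)} = {(I, y), (I, x)} \<or> {(i, j), (i, l)} = {(I, z), (I, x)}"
        by (simp add: B_def neq' insert_commute)
      from kl(3) show ?thesis
      proof
        assume "i = l \<and> j = k"
        then show ?thesis
          using long[rule_format, OF N(1,2) kl(1)] that(2,3) unfolding ab by simp
      next
        assume "i = k \<and> j \<noteq> l"
        then show ?thesis
          using short[rule_format, OF N kl(1)] kl(2) that(2,3) unfolding ab by simp
      qed
    qed
    then have "S \<subseteq> B \<union> B\<inverse>" unfolding S_def by blast
    moreover have "B \<subseteq> S"
      using lt neq' by (simp add: B_def S_def trunc_tetra_def doubleton_eq_iff)
    moreover have "S\<inverse> \<subseteq> S"
    proof clarify
      fix a b assume "(a, b) \<in> S"
      moreover have "(b, a) \<in> parcs trunc_tetra" if "(a, b) \<in> parcs trunc_tetra"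
        using that by (auto simp: trunc_tetra_def)
      ultimately show "(b, a) \<in> S" by (simp add: S_def insert_commute[of b a])
    qed
    then have "B\<inverse> \<subseteq> S" using \<open>B \<subseteq> S\<close> by blast
    ultimately show ?thesis by blast
  qed
  have pairs: "{(Old a, Old b) |a b. P a b} = (\<lambda>(a, b). (Old a, Old b)) ` {(a, b). P a b}"
    for P :: "nat \<times> nat \<Rightarrow> nat \<times> nat \<Rightarrow> bool"
    by auto
  have old: "{(Old a, Old b) |a b. (a, b) \<in> parcs trunc_tetra \<and>
      {a, b} \<noteq> {(I, y), (I, x)} \<and> {a, b} \<noteq> {(I, z), (I, x)}} =
      (\<lambda>(a, b). (Old a, Old b)) ` (B \<union> B\<inverse>)"
    unfolding SB[symmetric] S_def by (rule pairs)
  have "{..s} = insert 0 {1..s}" by auto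
  then have rungs: "(\<lambda>i. (U i, W i)) ` {..s} = insert (Old (I, y), Old (I, z)) {(SubU i, SubW i) |i. 1 \<le> i \<and> i \<le> s}"
    by auto
  have rails: "{(f i, f (i + 1)) |i. i \<le> s} = (\<lambda>i. (f i, f (Suc i))) ` {..s}" for f :: "nat \<Rightarrow> (nat \<times> nat) ladder_vertex"
    by auto
  have image_sym: "(\<lambda>(a, b). (Old a, Old b)) ` (X \<union> X\<inverse>) =
      (\<lambda>(a, b). (Old a, Old b)) ` X \<union> ((\<lambda>(a, b). (Old a, Old b)) ` X)\<inverse>" for X :: "(nat \<times> nat) rel"
    by force
  have regroup: "(insert d E \<union> (insert d E)\<inverse>) \<union> (R1 \<union> R2 \<union> R3) \<union> (R1 \<union> R2 \<union> R3)\<inverse> =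
      (E \<union> R1 \<union> R2 \<union> insert d R3) \<union> (E \<union> R1 \<union> R2 \<union> insert d R3)\<inverse>" for d and E R1 R2 R3 :: "'b rel"
    by blast
  have fixed: "(\<lambda>(a, b). (Old a, Old b)) ` B = insert (Old (I, y), Old (I, z)) fixed_half"
    by (simp add: B_def fixed_half_def)
  show ?thesis
    unfolding H_def ladder_graph_def Let_def pair_pre_digraph.simps old half_def rungs rails
      image_sym fixed
    by (rule regroup)
qed

lemma arc_H_iff: "(p, q) \<in> parcs H \<longleftrightarrow> (p, q) \<in> fixed_half \<or> (q, p) \<in> fixed_half \<or>
    (\<exists>i\<le>s. p = U i \<and> q = U (Suc i) \<or> q = U i \<and> p = U (Suc i) \<or>
      p = W i \<and> q = W (Suc i) \<or> q = W i \<and> p = W (Suc i) \<or>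
      p = U i \<and> q = W i \<or> q = U i \<and> p = W i)"
  unfolding parcs_H half_def by blast

lemma nbrs_Old:
  "{q. (Old (x, I), q) \<in> parcs H} = {Old (x, z), Old (x, y), Old (I, x)}"
  "{q. (Old (x, y), q) \<in> parcs H} = {Old (x, I), Old (x, z), Old (y, x)}"
  "{q. (Old (x, z), q) \<in> parcs H} = {Old (x, y), Old (x, I), Old (z, x)}"
  "{q. (Old (y, I), q) \<in> parcs H} = {Old (y, x), Old (y, z), Old (I, y)}"
  "{q. (Old (y, z), q) \<in> parcs H} = {Old (y, I), Old (y, x), Old (z, y)}"
  "{q. (Old (y, x), q) \<in> parcs H} = {Old (y, z), Old (y, I), Old (x, y)}"
  "{q. (Old (z, I), q) \<in> parcs H} = {Old (z, y), Old (z, x), Old (I, z)}"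
  "{q. (Old (z, x), q) \<in> parcs H} = {Old (z, I), Old (z, y), Old (x, z)}"
  "{q. (Old (z, y), q) \<in> parcs H} = {Old (z, x), Old (z, I), Old (y, z)}"
  by (rule set_eqI, simp add: arc_H_iff fixed_half_def neq', blast)+

lemma nbrs_ladder:
  "{q. (Old (I, x), q) \<in> parcs H} = {Old (x, I), U s, W s}"
  "{q. (Old (I, y), q) \<in> parcs H} = {Old (y, I), Old (I, z), U (Suc 0)}"
  "{q. (Old (I, z), q) \<in> parcs H} = {Old (I, y), Old (z, I), W (Suc 0)}"
  "i < s \<Longrightarrow> {q. (U (Suc i), q) \<in> parcs H} = {U i, W (Suc i), U (Suc (Suc i))}"
  "i < s \<Longrightarrow> {q. (W (Suc i), q) \<in> parcs H} = {W i, W (Suc (Suc i)), U (Suc i)}"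
proof -
  have last: "i \<le> s \<Longrightarrow> s < Suc i \<longleftrightarrow> i = s" for i by auto
  show "{q. (Old (I, x), q) \<in> parcs H} = {Old (x, I), U s, W s}"
    by (rule set_eqI, simp add: arc_H_iff fixed_half_def neq' last cong: conj_cong) blast
  show "{q. (Old (I, y), q) \<in> parcs H} = {Old (y, I), Old (I, z), U (Suc 0)}"
    by (rule set_eqI, simp add: arc_H_iff fixed_half_def neq' cong: conj_cong) blast
  show "{q. (Old (I, z), q) \<in> parcs H} = {Old (I, y), Old (z, I), W (Suc 0)}"
    by (rule set_eqI, simp add: arc_H_iff fixed_half_def neq' cong: conj_cong) auto
  assume "i < s"
  then have "Suc i \<le> s" "i \<le> s" by simp_all
  then show "{q. (U (Suc i), q) \<in> parcs H} = {U i, W (Suc i), U (Suc (Suc i))}"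
    by (intro set_eqI, simp add: arc_H_iff fixed_half_def neq' cong: conj_cong del: U_simps W_simps) (auto intro: exI[of _ i])
  from \<open>Suc i \<le> s\<close> \<open>i \<le> s\<close> show "{q. (W (Suc i), q) \<in> parcs H} = {W i, W (Suc (Suc i)), U (Suc i)}"
    by (intro set_eqI, simp add: arc_H_iff fixed_half_def neq' cong: conj_cong del: U_simps W_simps) (auto intro: exI[of _ i])
qed

lemma U_neq_SubW [simp]: "U i \<noteq> SubW j" "SubW j \<noteq> U i" "W i \<noteq> SubU j" "SubU j \<noteq> W i"
  by (auto simp: ladder_u_def ladder_w_def)

text \<open>The whole local picture at a vertex, so that one table yields both the degree and the
  rotation condition.\<close>

definition corner where
  "corner q a b c \<longleftrightarrow> distinct [a, b, c] \<and> {r. (q, r) \<in> parcs H} = {a, b, c} \<and> rotates q a b c"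

lemma corners:
  "corner (Old (x, I)) (Old (x, z)) (Old (x, y)) (Old (I, x))"
  "corner (Old (x, y)) (Old (x, I)) (Old (x, z)) (Old (y, x))"
  "corner (Old (x, z)) (Old (x, y)) (Old (x, I)) (Old (z, x))"
  "corner (Old (y, I)) (Old (y, x)) (Old (y, z)) (Old (I, y))"
  "corner (Old (y, z)) (Old (y, I)) (Old (y, x)) (Old (z, y))"
  "corner (Old (y, x)) (Old (y, z)) (Old (y, I)) (Old (x, y))"
  "corner (Old (z, I)) (Old (z, y)) (Old (z, x)) (Old (I, z))"
  "corner (Old (z, x)) (Old (z, I)) (Old (z, y)) (Old (x, z))"
  "corner (Old (z, y)) (Old (z, x)) (Old (z, I)) (Old (y, z))"
  "corner (Old (I, x)) (Old (x, I)) (U s) (W s)"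
  "corner (Old (I, y)) (Old (y, I)) (Old (I, z)) (U (Suc 0))"
  "corner (Old (I, z)) (Old (I, y)) (Old (z, I)) (W (Suc 0))"
  "i < s \<Longrightarrow> corner (U (Suc i)) (U i) (W (Suc i)) (U (Suc (Suc i)))"
  "i < s \<Longrightarrow> corner (W (Suc i)) (W i) (W (Suc (Suc i))) (U (Suc i))"
  unfolding corner_def nbrs_Old nbrs_ladder
  using rotates_Sub[of "Suc i"] by (simp_all add: rotates_Old nbrs_ladder neq')

lemma ex_corner:
  assumes "q \<in> pverts H"
  shows "\<exists>a b c. corner q a b c"
proof -
  have le: "i = 0 \<or> i = Suc s \<or> (\<exists>j<s. i = Suc j)" if "i \<le> Suc s" for i
    using that by (cases i) auto
  have U: "\<exists>a b c. corner (U i) a b c" if "i \<le> Suc s" for i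
    using le[OF that]
  proof (elim disjE exE conjE)
    show "i = 0 \<Longrightarrow> ?thesis" using corners(11) by (simp, blast)
    show "i = Suc s \<Longrightarrow> ?thesis" using corners(10) by (simp, blast)
    fix j assume "j < s" "i = Suc j"
    then show ?thesis using corners(13) by blast
  qed
  have W: "\<exists>a b c. corner (W i) a b c" if "i \<le> Suc s" for i
    using le[OF that]
  proof (elim disjE exE conjE)
    show "i = 0 \<Longrightarrow> ?thesis" using corners(12) by (simp, blast)
    show "i = Suc s \<Longrightarrow> ?thesis" using corners(10) by (simp, blast)
    fix j assume "j < s" "i = Suc j"
    then show ?thesis using corners(14) by blast
  qed
  show ?thesis
    using assms unfolding pverts_H
  proof (elim UnE imageE insertE emptyE)
    fix i assume "q = U i" "i \<in> {..Suc s}"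
    then show ?thesis using U by simp
  next
    fix i assume "q = W i" "i \<in> {..Suc s}"
    then show ?thesis using W by simp
  qed (hypsubst, rule exI, rule exI, rule exI, rule corners)+
qed

section \<open>A cubic graph with a Hamiltonian cycle\<close>

lemma arc_sym: "(p, q) \<in> parcs H \<Longrightarrow> (q, p) \<in> parcs H"
  by (auto simp: parcs_H)

lemma half_verts: "half \<subseteq> pverts H \<times> pverts H - Id"
proof -
  have "Old (I, x) \<in> U ` {..Suc s}" "Old (I, y) \<in> U ` {..Suc s}" "Old (I, z) \<in> W ` {..Suc s}"
    by (rule image_eqI[of _ _ "Suc s"] image_eqI[of _ _ 0]; simp)+
  then have "fixed_half \<subseteq> pverts H \<times> pverts H - Id"
    unfolding pverts_H fixed_half_def by (simp add: neq')
  moreover have "(U i, U (Suc i)) \<in> pverts H \<times> pverts H - Id"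
    "(W i, W (Suc i)) \<in> pverts H \<times> pverts H - Id" "(U i, W i) \<in> pverts H \<times> pverts H - Id"
    if "i \<le> s" for i
    using that by (auto simp: pverts_H)
  ultimately show ?thesis by (auto simp: half_def)
qed

lemma pair_graph_H: "pair_graph H"
proof unfold_locales
  have arcs: "fst e \<in> pverts H \<and> snd e \<in> pverts H \<and> fst e \<noteq> snd e" if "e \<in> parcs H" for e
    using that half_verts unfolding parcs_H by (cases e) auto
  show "finite (pverts H)" by (simp add: pverts_H)
  moreover have "parcs H \<subseteq> pverts H \<times> pverts H"
    using arcs by force
  ultimately show "finite (parcs H)" using finite_subset by blast
  show "fst e \<in> pverts H" "snd e \<in> pverts H" "fst e \<noteq> snd e" if "e \<in> parcs H" for e
    using arcs[OF that] by auto
  show "symmetric (with_proj H)"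
    using arc_sym by (auto simp: symmetric_def sym_def)
qed

lemma cubic_H: "q \<in> pverts H \<Longrightarrow> card {r. (q, r) \<in> parcs H} = 3"
  using ex_corner[of q] by (auto simp: corner_def)

lemma cyclic_on_rot: "q \<in> pverts H \<Longrightarrow> cyclic_on (rot q) {r. (q, r) \<in> parcs H}"
proof -
  assume "q \<in> pverts H"
  then obtain a b c where c: "{r. (q, r) \<in> parcs H} = {a, b, c}" "rotates q a b c"
    using ex_corner unfolding corner_def by blast
  have "{a, b, c} = {a, c, b}" by auto
  then show ?thesis
    using c(2) cyclic_on_triple[of "rot q" a b c] cyclic_on_triple[of "rot q" a c b] unfolding c(1)
    by (auto simp: rotates_def turn_def split: if_splits)
qed

text \<open>Along the rail from \<open>u\<close> to \<open>v\<close> and back along the other rail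
  to \<open>w\<close>, starting with \<open>W s\<close> because \<open>W (Suc s)\<close> is
  \<open>v\<close> again; then through the triangles at \<open>z\<close>, \<open>x\<close>,
  \<open>y\<close> and back to \<open>u\<close>.\<close>

definition ham where
  "ham = map U [0..<Suc (Suc s)] @ map W (rev [0..<Suc s]) @
    [Old (z, I), Old (z, y), Old (z, x), Old (x, z), Old (x, I), Old (x, y), Old (y, x), Old (y, z), Old (y, I)]"

lemma successively_upt: "(\<And>i. m \<le> i \<Longrightarrow> Suc i < n \<Longrightarrow> P i (Suc i)) \<Longrightarrow> successively P [m..<n]"
  by (simp add: successively_conv_nth)

lemma fixed_arcs: "d \<in> fixed_half \<Longrightarrow> d \<in> parcs H" "prod.swap d \<in> fixed_half \<Longrightarrow> d \<in> parcs H"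
  by (cases d; simp add: parcs_H half_def)+

lemma ladder_arcs:
  "i \<le> s \<Longrightarrow> (U i, U (Suc i)) \<in> parcs H" "i \<le> s \<Longrightarrow> (U (Suc i), U i) \<in> parcs H"
  "i \<le> s \<Longrightarrow> (W i, W (Suc i)) \<in> parcs H" "i \<le> s \<Longrightarrow> (W (Suc i), W i) \<in> parcs H"
  "i \<le> s \<Longrightarrow> (U i, W i) \<in> parcs H" "i \<le> s \<Longrightarrow> (W i, U i) \<in> parcs H"
  unfolding arc_H_iff by blast+

lemma ham_props:
  "successively (\<lambda>a b. (a, b) \<in> parcs H) ham" "(last ham, hd ham) \<in> parcs H"
  "distinct ham" "set ham = pverts H" "length ham = 2 * s + 12"
proof -
  have U: "successively (\<lambda>i j. (U i, U j) \<in> parcs H) [0..<Suc (Suc s)]"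
    by (rule successively_upt) (rule ladder_arcs, simp)
  have W: "successively (\<lambda>i j. (W j, W i) \<in> parcs H) [0..<Suc s]"
    by (rule successively_upt) (rule ladder_arcs, simp)
  have "(U (Suc s), W s) \<in> parcs H" using ladder_arcs(4)[of s] by simp
  then have mid: "(Old (I, x), W s) \<in> parcs H" by simp
  have out: "set [(Old (I, z), Old (z, I)), (Old (z, I), Old (z, y)), (Old (z, y), Old (z, x)),
      (Old (z, x), Old (x, z)), (Old (x, z), Old (x, I)), (Old (x, I), Old (x, y)),
      (Old (x, y), Old (y, x)), (Old (y, x), Old (y, z)), (Old (y, z), Old (y, I)),
      (Old (y, I), Old (I, y))] \<subseteq> parcs H"
    by (simp add: parcs_H half_def fixed_half_def)
  have hd: "hd (map U [0..<Suc (Suc s)]) = Old (I, y)" "hd (map W (rev [0..<Suc s])) = W s"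
    "last (map U [0..<Suc (Suc s)]) = Old (I, x)" "last (map W (rev [0..<Suc s])) = Old (I, z)"
    by (simp_all add: hd_map hd_rev last_rev last_map hd_append del: map_append) (simp add: ladder_w_def)
  show "successively (\<lambda>a b. (a, b) \<in> parcs H) ham"
    using U W mid out hd unfolding ham_def
    by (simp add: successively_append_iff successively_map successively_Cons del: upt_Suc list.map map_append)
  show "(last ham, hd ham) \<in> parcs H"
    using out hd(1) by (simp add: ham_def del: upt_Suc)
  define A where "A = map U [0..<Suc (Suc s)]"
  define B where "B = map W (rev [0..<Suc s])"
  define C where "C = [Old (z, I), Old (z, y), Old (z, x), Old (x, z), Old (x, I), Old (x, y),
    Old (y, x), Old (y, z), Old (y, I)]"
  have "distinct A" "distinct B"
    by (simp_all add: A_def B_def distinct_map inj_on_def del: upt_Suc)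
  moreover have "distinct C" by (simp add: C_def neq')
  moreover have "set A \<inter> set B = {}"
    by (auto simp: A_def B_def simp del: upt_Suc)
  moreover have "Old (p, q) \<notin> set A \<and> Old (p, q) \<notin> set B" if "p \<noteq> I" for p q
    using that by (auto simp: A_def B_def simp del: upt_Suc)
  then have "set C \<inter> (set A \<union> set B) = {}"
    by (simp add: C_def neq')
  ultimately have "distinct (A @ B @ C)" unfolding distinct_append set_append by blast
  then show "distinct ham" by (simp only: ham_def A_def B_def C_def)
  have "{..Suc s} = insert (Suc s) {0..<Suc s}" by auto
  then have W: "W ` {..Suc s} = insert (U (Suc s)) (W ` {0..<Suc s})" by simp
  have "{0..<Suc (Suc s)} = {..Suc s}" by auto
  then show "set ham = pverts H"
    unfolding ham_def pverts_H W set_append set_map set_rev set_upt by (auto simp del: U_simps W_simps)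
  show "length ham = 2 * s + 12" by (simp add: ham_def)
qed

lemma two_connected_H: "two_connected H"
  using two_connected_pairI[OF ham_props(1-4)] ham_props(5) by simp

lemma hamiltonian_H: "hamiltonian H"
  using hamiltonian_pairI[OF ham_props(1-4)] ham_props(5) by simp

lemma card_pverts_H: "card (pverts H) = 2 * s + 12"
  using ham_props(3-5) distinct_card by metis

section \<open>Boundary walks of the faces\<close>

definition link where
  "link d d' \<longleftrightarrow> snd d = fst d' \<and> turn (fst d) (snd d) (snd d')"

text \<open>Both distinctness conditions are recorded because reading a walk backwards exchanges
  leaving and entering a vertex; \<open>once\<close> is needed in either orientation.\<close>

definition face_cycle where
  "face_cycle A \<longleftrightarrow> A \<noteq> [] \<and> successively link A \<and> link (last A) (hd A) \<and>
     distinct (map fst A) \<and> distinct (map snd A)"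

text \<open>\<open>Tx\<close>, \<open>Ty\<close>, \<open>Tz\<close> are the triangles at
  \<open>x\<close>, \<open>y\<close>, \<open>z\<close>. The walks \<open>hI\<close>,
  \<open>hx\<close>, \<open>hy\<close>, \<open>hz\<close> come from the old hexagons opposite to
  \<open>I\<close>, \<open>x\<close>, \<open>y\<close>, \<open>z\<close>; the rails lengthen
  \<open>hy\<close> and \<open>hz\<close>.\<close>

definition Tx where "Tx = [(Old (x, I), Old (x, y)), (Old (x, y), Old (x, z)), (Old (x, z), Old (x, I))]"
definition Ty where "Ty = [(Old (y, I), Old (y, z)), (Old (y, z), Old (y, x)), (Old (y, x), Old (y, I))]"
definition Tz where "Tz = [(Old (z, I), Old (z, x)), (Old (z, x), Old (z, y)), (Old (z, y), Old (z, I))]"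
definition hI where "hI = [(Old (x, z), Old (x, y)), (Old (x, y), Old (y, x)), (Old (y, x), Old (y, z)),
  (Old (y, z), Old (z, y)), (Old (z, y), Old (z, x)), (Old (z, x), Old (x, z))]"
definition hx where "hx = [(Old (y, z), Old (y, I)), (Old (y, I), Old (I, y)), (Old (I, y), Old (I, z)),
  (Old (I, z), Old (z, I)), (Old (z, I), Old (z, y)), (Old (z, y), Old (y, z))]"
definition hy where "hy = map (\<lambda>i. (W i, W (Suc i))) [0..<Suc s] @
  [(Old (I, x), Old (x, I)), (Old (x, I), Old (x, z)), (Old (x, z), Old (z, x)),
   (Old (z, x), Old (z, I)), (Old (z, I), Old (I, z))]"
definition hz where "hz = map (\<lambda>i. (U (Suc i), U i)) (rev [0..<Suc s]) @
  [(Old (I, y), Old (y, I)), (Old (y, I), Old (y, x)), (Old (y, x), Old (x, y)),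
   (Old (x, y), Old (x, I)), (Old (x, I), Old (I, x))]"
text \<open>The cells of the ladder: quadrilaterals, except that the last one is a triangle because
  both rails end in \<open>v\<close>.\<close>

definition Q where "Q i =
  (if i < s then [(W (Suc i), W i), (W i, U i), (U i, U (Suc i)), (U (Suc i), W (Suc i))]
   else [(Old (I, x), W s), (W s, U s), (U s, Old (I, x))])"

lemma face_cycle_fixed: "face_cycle Tx" "face_cycle Ty" "face_cycle Tz" "face_cycle hI" "face_cycle hx"
  using rotates_Old
  by (simp_all add: face_cycle_def link_def rotates_def Tx_def Ty_def Tz_def hI_def hx_def neq' neq)

lemma Old_notin_ladder:
  "p \<noteq> I \<or> q = x \<Longrightarrow> Old (p, q) \<notin> U ` {0..<Suc s}"
  "p \<noteq> I \<or> q = x \<Longrightarrow> Old (p, q) \<notin> W ` {0..<Suc s}"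
  "p \<noteq> I \<or> q = y \<Longrightarrow> Old (p, q) \<notin> (\<lambda>i. U (Suc i)) ` {0..<Suc s}"
  "p \<noteq> I \<or> q = z \<Longrightarrow> Old (p, q) \<notin> (\<lambda>i. W (Suc i)) ` {0..<Suc s}"
  using neq by auto

lemma distinct_ladder:
  "distinct (map U [0..<Suc s])" "distinct (map W [0..<Suc s])"
  "distinct (map (\<lambda>i. U (Suc i)) [0..<Suc s])" "distinct (map (\<lambda>i. W (Suc i)) [0..<Suc s])"
  by (simp_all add: distinct_map inj_on_def del: upt_Suc)

lemma face_cycle_hy: "face_cycle hy"
proof -
  let ?A = "map (\<lambda>i. (W i, W (Suc i))) [0..<Suc s]"
  let ?B = "[(Old (I, x), Old (x, I)), (Old (x, I), Old (x, z)), (Old (x, z), Old (z, x)),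
   (Old (z, x), Old (z, I)), (Old (z, I), Old (I, z))]"
  have "successively (\<lambda>i j. link (W i, W (Suc i)) (W j, W (Suc j))) [0..<Suc s]"
    by (rule successively_upt) (simp only: link_def fst_conv snd_conv, simp only: turn_ladder Suc_less_eq simp_thms)
  then have "successively link ?A" by (simp only: successively_map)
  moreover have hd: "hd ?A = (W 0, W (Suc 0))" "last ?A = (W s, W (Suc s))"
    by (simp_all add: hd_map last_map hd_append del: map_append W_simps)
  moreover have "successively link ?B" "link (W s, W (Suc s)) (hd ?B)" "link (last ?B) (W 0, W (Suc 0))"
    using rotates_Old by (simp_all add: link_def rotates_def)
  moreover have "distinct (map fst (?A @ ?B))"
    using distinct_ladder(2) by (simp add: comp_def Old_notin_ladder neq' del: upt_Suc)
  moreover have "distinct (map snd (?A @ ?B))"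
    using distinct_ladder(4) by (simp add: comp_def Old_notin_ladder neq' del: upt_Suc)
  ultimately show ?thesis
    unfolding face_cycle_def hy_def successively_append_iff by (simp del: W_simps upt_Suc)
qed

lemma face_cycle_hz: "face_cycle hz"
proof -
  let ?A = "map (\<lambda>i. (U (Suc i), U i)) (rev [0..<Suc s])"
  let ?B = "[(Old (I, y), Old (y, I)), (Old (y, I), Old (y, x)), (Old (y, x), Old (x, y)),
   (Old (x, y), Old (x, I)), (Old (x, I), Old (I, x))]"
  have "successively (\<lambda>i j. link (U (Suc j), U j) (U (Suc i), U i)) [0..<Suc s]"
    by (rule successively_upt) (simp only: link_def fst_conv snd_conv, simp only: turn_ladder Suc_less_eq simp_thms)
  then have "successively link ?A" by (simp only: successively_map successively_rev)
  moreover have hd: "last ?A = (U (Suc 0), U 0)" "hd ?A = (U (Suc s), U s)"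
    by (simp_all add: hd_map last_map hd_append last_rev hd_rev del: map_append U_simps)
  moreover have "successively link ?B" "link (U (Suc 0), U 0) (hd ?B)" "link (last ?B) (U (Suc s), U s)"
    using rotates_Old by (simp_all add: link_def rotates_def)
  moreover have "distinct (map fst (?A @ ?B))"
    using distinct_ladder(3) by (simp add: comp_def Old_notin_ladder neq' rev_map[symmetric] del: upt_Suc)
  moreover have "distinct (map snd (?A @ ?B))"
    using distinct_ladder(1) by (simp add: comp_def Old_notin_ladder neq' rev_map[symmetric] del: upt_Suc)
  ultimately show ?thesis
    unfolding face_cycle_def hz_def successively_append_iff by (simp del: U_simps upt_Suc)
qed

lemma face_cycle_Q:
  assumes "i \<le> s"
  shows "face_cycle (Q i)"
proof (cases "i < s")
  case True
  then show ?thesis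
    by (simp add: Q_def face_cycle_def link_def turn_ladder del: U_simps(3) W_simps(3))
next
  case False
  then have i: "i = s" using assms by simp
  have "turn (W s) (U s) (Old (I, x))" "turn (Old (I, x)) (W s) (U s)"
    using turn_ladder(3,4)[of s] by simp_all
  then show ?thesis
    using rotates_Old by (simp add: i Q_def face_cycle_def link_def rotates_def neq')
qed

section \<open>All faces and a Hamiltonian cycle of the dual\<close>

text \<open>The order is that of a Hamiltonian cycle of the dual graph, which crosses \<open>dualArcs\<close> below.\<close>

definition faceList where
  "faceList = hx # map Q [0..<Suc s] @ [hy, Tx, hz, Ty, hI, Tz]"

lemma face_cycle_faceList: "A \<in> set faceList \<Longrightarrow> face_cycle A"
  using face_cycle_fixed face_cycle_hy face_cycle_hz face_cycle_Q
  by (auto simp: faceList_def simp del: upt_Suc)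

lemma ladder_arc_faces:
  "i \<le> s \<Longrightarrow> (W (Suc i), W i) \<in> set (Q i)" "i \<le> s \<Longrightarrow> (W i, U i) \<in> set (Q i)"
  "i \<le> s \<Longrightarrow> (U i, U (Suc i)) \<in> set (Q i)" "i < s \<Longrightarrow> (U (Suc i), W (Suc i)) \<in> set (Q i)"
  "i \<le> s \<Longrightarrow> (W i, W (Suc i)) \<in> set hy" "i \<le> s \<Longrightarrow> (U (Suc i), U i) \<in> set hz"
  "(U 0, W 0) \<in> set hx"
proof -
  show "i \<le> s \<Longrightarrow> (W (Suc i), W i) \<in> set (Q i)" "i \<le> s \<Longrightarrow> (W i, U i) \<in> set (Q i)"
    "i \<le> s \<Longrightarrow> (U i, U (Suc i)) \<in> set (Q i)" "i < s \<Longrightarrow> (U (Suc i), W (Suc i)) \<in> set (Q i)"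
    by (cases "i = s"; simp add: Q_def)+
  show "i \<le> s \<Longrightarrow> (W i, W (Suc i)) \<in> set hy" "i \<le> s \<Longrightarrow> (U (Suc i), U i) \<in> set hz"
    unfolding hy_def hz_def set_append set_map set_rev set_upt by (auto simp del: U_simps W_simps)
  show "(U 0, W 0) \<in> set hx" by (simp add: hx_def)
qed

lemma Q_arcs: "i \<le> s \<Longrightarrow> set (Q i) \<subseteq> parcs H"
  using ladder_arcs[of i] ladder_arcs(5)[of "Suc i"]
  by (cases "i = s") (auto simp: Q_def simp del: U_simps(3) W_simps(3))

lemma faces_cover: "(\<Union>A\<in>set faceList. set A) = parcs H"
proof -
  let ?F = "\<Union>A\<in>set faceList. set A"
  have Q: "d \<in> ?F" if "d \<in> set (Q i)" "i \<le> s" for d i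
    using that by (auto simp: faceList_def simp del: upt_Suc)
  have sub: "set hx \<subseteq> ?F" "set hy \<subseteq> ?F" "set Tx \<subseteq> ?F" "set hz \<subseteq> ?F" "set Ty \<subseteq> ?F" "set hI \<subseteq> ?F" "set Tz \<subseteq> ?F"
    by (auto simp: faceList_def simp del: upt_Suc)
  have any: "d \<in> ?F" if "d \<in> set hx \<or> d \<in> set hy \<or> d \<in> set Tx \<or> d \<in> set hz \<or> d \<in> set Ty \<or> d \<in> set hI \<or> d \<in> set Tz" for d
    using that by (simp add: faceList_def del: upt_Suc) argo
  have fixed: "\<forall>d\<in>fixed_half. (d \<in> set hx \<or> d \<in> set hy \<or> d \<in> set Tx \<or> d \<in> set hz \<or> d \<in> set Ty \<or> d \<in> set hI \<or> d \<in> set Tz) \<and>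
      (prod.swap d \<in> set hx \<or> prod.swap d \<in> set hy \<or> prod.swap d \<in> set Tx \<or> prod.swap d \<in> set hz \<or> prod.swap d \<in> set Ty \<or>
       prod.swap d \<in> set hI \<or> prod.swap d \<in> set Tz)"
    by (simp add: fixed_half_def hx_def hy_def Tx_def hz_def Ty_def hI_def Tz_def del: upt_Suc)
  have rail: "(U i, U (Suc i)) \<in> ?F" "(U (Suc i), U i) \<in> ?F" "(W i, W (Suc i)) \<in> ?F" "(W (Suc i), W i) \<in> ?F"
    "(W i, U i) \<in> ?F" "(U i, W i) \<in> ?F" if i: "i \<le> s" for i
  proof -
    show "(U i, U (Suc i)) \<in> ?F" "(W (Suc i), W i) \<in> ?F" "(W i, U i) \<in> ?F"
      using Q ladder_arc_faces(1-3)[OF i] i by blast+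
    show "(U (Suc i), U i) \<in> ?F" "(W i, W (Suc i)) \<in> ?F"
      using sub ladder_arc_faces(5,6)[OF i] by blast+
    \<comment> \<open>This side of rung \<open>i\<close> belongs to the preceding cell, and for rung
      0, the old edge \<open>uw\<close>, to \<open>hx\<close>.\<close>
    show "(U i, W i) \<in> ?F"
    proof (cases i)
      case 0
      then show ?thesis using sub(1) ladder_arc_faces(7) by blast
    next
      case (Suc j)
      then show ?thesis using Q[of _ j] ladder_arc_faces(4)[of j] i by simp
    qed
  qed
  show ?thesis
  proof
    have "set hx \<subseteq> parcs H" "set Tx \<subseteq> parcs H" "set Ty \<subseteq> parcs H" "set hI \<subseteq> parcs H" "set Tz \<subseteq> parcs H"
      using ladder_arcs(5)[of 0]
      by (simp_all add: hx_def Tx_def Ty_def hI_def Tz_def parcs_H half_def fixed_half_def)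
    moreover have "set hy \<subseteq> parcs H" "set hz \<subseteq> parcs H"
      using ladder_arcs unfolding hy_def hz_def set_append set_map set_rev set_upt
      by (auto simp: fixed_half_def intro: fixed_arcs simp del: U_simps W_simps)
    moreover have "(\<Union>i\<in>{0..<Suc s}. set (Q i)) \<subseteq> parcs H"
      by (intro UN_least Q_arcs) simp
    ultimately show "?F \<subseteq> parcs H"
      by (simp add: faceList_def del: upt_Suc)
    show "parcs H \<subseteq> ?F"
    proof clarify
      fix p q assume "(p, q) \<in> parcs H"
      then consider "(p, q) \<in> fixed_half" | "(q, p) \<in> fixed_half" | i where "i \<le> s"
        "p = U i \<and> q = U (Suc i) \<or> q = U i \<and> p = U (Suc i) \<or>
          p = W i \<and> q = W (Suc i) \<or> q = W i \<and> p = W (Suc i) \<or>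
          p = U i \<and> q = W i \<or> q = U i \<and> p = W i"
        unfolding arc_H_iff by blast
      then show "(p, q) \<in> ?F"
      proof cases
        case 1
        show ?thesis by (rule any[OF bspec[OF fixed 1, THEN conjunct1]])
      next
        case 2
        show ?thesis by (rule any[OF bspec[OF fixed 2, THEN conjunct2, unfolded swap_simp]])
      next
        case 3
        then show ?thesis using rail[OF 3(1)] by (elim disjE conjE) (simp_all only:)
      qed
    qed
  qed
qed

text \<open>From \<open>hx\<close> through \<open>uw\<close> into the ladder, across all rungs, and
  out of the last cell through the edge from \<open>v\<close> to \<open>W s\<close>. From
  \<open>hy\<close> on, long faces and triangles alternate until \<open>hx\<close> is reached
  again.\<close>

definition dualArcs where
  "dualArcs = (Old (I, y), Old (I, z)) # map (\<lambda>i. (U (Suc i), W (Suc i))) [0..<s] @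
    [(Old (I, x), W s), (Old (x, I), Old (x, z)), (Old (x, I), Old (x, y)), (Old (y, I), Old (y, x)),
     (Old (y, z), Old (y, x)), (Old (z, y), Old (z, x)), (Old (z, y), Old (z, I))]"

lemma dualArcs_faces:
  "list_all2 (\<lambda>d A. d \<in> set A) dualArcs faceList"
  "list_all2 (\<lambda>d A. prod.swap d \<in> set A) dualArcs (rotate1 faceList)"
proof -
  \<comment> \<open>The last cell is split off because it is left through a rail edge, not through a
    rung.\<close>
  have "faceList = hx # map Q [0..<s] @ [Q s, hy, Tx, hz, Ty, hI, Tz]"
    by (simp add: faceList_def)
  moreover have "(Old (I, x), W s) \<in> set (Q s)" using ladder_arc_faces(1)[of s] by simp
  moreover have "list_all2 (\<lambda>d A. d \<in> set A) (map (\<lambda>i. (U (Suc i), W (Suc i))) [0..<s]) (map Q [0..<s])"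
    using ladder_arc_faces(4) by (simp add: list_all2_conv_all_nth del: U_simps W_simps)
  ultimately show "list_all2 (\<lambda>d A. d \<in> set A) dualArcs faceList"
    by (simp add: dualArcs_def list_all2_appendI hx_def hy_def Tx_def hz_def Ty_def hI_def Tz_def del: upt_Suc)
  have "rotate1 faceList = Q 0 # map (\<lambda>i. Q (Suc i)) [0..<s] @ [hy, Tx, hz, Ty, hI, Tz, hx]"
    by (simp add: faceList_def upt_conv_Cons map_Suc_upt[symmetric] del: upt_Suc)
  moreover have "(Old (I, z), Old (I, y)) \<in> set (Q 0)" using ladder_arc_faces(2)[of 0] by simp
  moreover have "(W s, Old (I, x)) \<in> set hy" using ladder_arc_faces(5)[of s] by simp
  moreover have "list_all2 (\<lambda>d A. prod.swap d \<in> set A) (map (\<lambda>i. (U (Suc i), W (Suc i))) [0..<s]) (map (\<lambda>i. Q (Suc i)) [0..<s])"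
    using ladder_arc_faces(2) by (simp add: list_all2_conv_all_nth Suc_le_eq del: U_simps W_simps)
  ultimately show "list_all2 (\<lambda>d A. prod.swap d \<in> set A) dualArcs (rotate1 faceList)"
    by (simp add: dualArcs_def list_all2_appendI hx_def Tx_def hz_def Ty_def hI_def Tz_def del: upt_Suc)
qed

text \<open>Tells the faces apart, except for those inside the old triangle \<open>u, v, w\<close>.\<close>

definition key where
  "key f = (Old (x, I) \<in> fst ` f, Old (y, I) \<in> fst ` f, Old (z, I) \<in> fst ` f, Old (x, y) \<in> fst ` f)"

lemma keys:
  "key (set hx) = (False, True, True, False)" "key (set hy) = (True, False, True, False)"
  "key (set hz) = (True, True, False, True)" "key (set Tx) = (True, False, False, True)"
  "key (set Ty) = (False, True, False, False)" "key (set Tz) = (False, False, True, False)"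
  "key (set hI) = (False, False, False, True)" "key (set (Q i)) = (False, False, False, False)"
proof -
  show "key (set hy) = (True, False, True, False)" "key (set hz) = (True, True, False, True)"
    by (simp_all add: key_def hy_def hz_def image_Un image_image Old_notin_ladder neq' del: upt_Suc)
qed (simp_all add: key_def hx_def Tx_def Ty_def Tz_def hI_def Q_def neq')

lemma distinct_faceList: "distinct (map set faceList)"
proof -
  let ?L = "[set hx, set hy, set Tx, set hz, set Ty, set hI, set Tz]"
  have "distinct (map key ?L)" by (simp add: keys)
  then have "distinct ?L" unfolding distinct_map by blast
  moreover have "inj_on (\<lambda>i. set (Q i)) {0..<Suc s}"
  proof (rule inj_onI)
    fix i j assume ij: "i \<in> {0..<Suc s}" "j \<in> {0..<Suc s}" "set (Q i) = set (Q j)"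
    \<comment> \<open>This arc occurs in no cell but the one with index \<open>i\<close>.\<close>
    then have "(W i, U i) \<in> set (Q j)" using ladder_arc_faces(2)[of i] by auto
    then show "i = j" using ij(1,2) neq by (auto simp: Q_def split: if_splits)
  qed
  then have "distinct (map (\<lambda>i. set (Q i)) [0..<Suc s])" by (simp add: distinct_map del: upt_Suc)
  moreover have "f \<notin> (\<lambda>i. set (Q i)) ` {0..<Suc s}" if "key f \<noteq> (False, False, False, False)" for f
    using that keys(8) by auto
  then have "\<forall>f\<in>set ?L. f \<notin> (\<lambda>i. set (Q i)) ` {0..<Suc s}" by (simp add: keys)
  ultimately show ?thesis
    unfolding faceList_def by (simp add: comp_def disjoint_iff del: upt_Suc)
qed

section \<open>Transfer to both orientations\<close>

definition mirror where "mirror d = (if pos then d else prod.swap d)"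

text \<open>If \<open>pos\<close> fails, \<open>face_step\<close> runs through the listed walks
  backwards: every arc is reversed, and so is their order.\<close>

definition orient where "orient A = (if pos then A else rev (map prod.swap A))"

lemma set_orient: "set (orient A) = mirror ` set A"
  by (auto simp: orient_def mirror_def)

lemma inj_mirror: "inj mirror"
  by (auto simp: inj_on_def mirror_def)

lemma orient_chain:
  assumes "face_cycle A"
  shows "orient A \<noteq> [] \<and> successively (\<lambda>d d'. face_step rot d = d') (orient A) \<and>
    face_step rot (last (orient A)) = hd (orient A)"
proof -
  have A: "A \<noteq> []" "successively link A" "link (last A) (hd A)"
    using assms by (auto simp: face_cycle_def)
  show ?thesis
  proof (cases pos)
    case True
    then have step: "face_step rot d = d'" if "link d d'" for d d'
      using that by (cases d; cases d') (simp add: link_def turn_def face_step_def)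
    then show ?thesis
      using A True by (auto simp: orient_def intro: successively_mono[OF A(2)])
  next
    case False
    then have step: "face_step rot (prod.swap d') = prod.swap d" if "link d d'" for d d'
      using that by (cases d; cases d') (simp add: link_def turn_def face_step_def)
    have "successively (\<lambda>d d'. face_step rot (prod.swap d') = prod.swap d) A"
      by (rule successively_mono[OF A(2)]) (rule step)
    then show ?thesis
      using A False step
      by (simp add: orient_def successively_map last_rev hd_rev hd_map last_map)
  qed
qed

lemma
  shows oriented_chain: "\<And>A. A \<in> set (map orient faceList) \<Longrightarrow> A \<noteq> [] \<and>
      successively (\<lambda>d d'. face_step rot d = d') A \<and> face_step rot (last A) = hd A"
    and oriented_cover: "(\<Union>A\<in>set (map orient faceList). set A) = parcs H"
proof -
  show "A \<noteq> [] \<and> successively (\<lambda>d d'. face_step rot d = d') A \<and> face_step rot (last A) = hd A"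
    if "A \<in> set (map orient faceList)" for A
    using that orient_chain face_cycle_faceList by auto
  have "(\<Union>A\<in>set (map orient faceList). set A) = mirror ` (\<Union>A\<in>set faceList. set A)"
    by (simp add: set_orient image_UN)
  also have "\<dots> = parcs H"
    unfolding faces_cover using arc_sym by (force simp: mirror_def image_iff)
  finally show "(\<Union>A\<in>set (map orient faceList). set A) = parcs H" .
qed

lemma faces_H: "faces H rot = (\<lambda>A. mirror ` set A) ` set faceList"
  using faces_eq_certificate[OF oriented_chain oriented_cover] by (simp add: image_image set_orient)

lemma distinct_oriented: "distinct (map set (map orient faceList))"
proof -
  have "map set (map orient faceList) = map (image mirror) (map set faceList)"
    by (simp add: set_orient)
  moreover have "inj_on (image mirror) (set (map set faceList))"
    using inj_mirror by (meson inj_image_eq_iff inj_onI)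
  ultimately show ?thesis using distinct_faceList by (metis distinct_map)
qed

lemma length_faceList: "length faceList = s + 8"
  by (simp add: faceList_def)

lemma card_faces_H: "card (faces H rot) = s + 8"
  using faces_eq_certificate[OF oriented_chain oriented_cover] distinct_card[OF distinct_oriented]
  by (simp add: length_faceList image_image)

text \<open>Reflecting arcs and boundary walks together preserves incidence, so the same cyclic
  order of faces works in both orientations.\<close>

lemma hamiltonian_dual_H: "hamiltonian (dual_graph H rot)"
proof (rule hamiltonian_dual_certificate[OF oriented_chain oriented_cover])
  show "list_all2 (\<lambda>d A. d \<in> set A) (map mirror dualArcs) (map orient faceList)"
    using dualArcs_faces(1) by (auto simp: list.rel_map set_orient elim!: list_all2_mono)
  have "prod.swap (mirror d) \<in> set (orient A)" if "prod.swap d \<in> set A" for d A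
    using imageI[OF that, of mirror] unfolding set_orient by (cases pos) (simp_all add: mirror_def)
  then show "list_all2 (\<lambda>d A. prod.swap d \<in> set A) (map mirror dualArcs) (rotate1 (map orient faceList))"
    using dualArcs_faces(2) by (auto simp: rotate1_map list.rel_map elim!: list_all2_mono)
  show "distinct (map set (map orient faceList))" by (rule distinct_oriented)
  show "3 \<le> length (map orient faceList)" by (simp add: length_faceList)
qed

text \<open>Euler's formula by counting: \<open>2 * s + 12\<close> vertices of degree three give
  \<open>3 * s + 18\<close> edges, and there are \<open>s + 8\<close> faces.\<close>

lemma plane_graph_H: "plane_graph H rot"
proof -
  have "2 * card (edges H) = 3 * card (pverts H)"
    using card_edges_double[OF pair_graph_H] card_parcs_cubic[OF pair_graph_H cubic_H] by simp
  moreover have "Digraph_Component.connected H" using two_connected_H by (simp add: two_connected_def)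
  ultimately show ?thesis
    using pair_graph_H cyclic_on_rot by (simp add: plane_graph_def card_pverts_H card_faces_H)
qed

lemma no_rhombic_strip_H: "\<not> admits_rhombic_strip (face_lattice H rot) face_rank"
proof (rule no_rhombic_strip_if_triangles)
  show "plane_graph H rot" by (rule plane_graph_H)
  show "card {r. (q, r) \<in> parcs H} = 3" if "q \<in> pverts H" for q using that by (rule cubic_H)
  show "b = c" if "f \<in> faces H rot" "(a, b) \<in> f" "(a, c) \<in> f" for f a b c
  proof -
    obtain A where A: "A \<in> set faceList" "f = mirror ` set A" using \<open>f \<in> faces H rot\<close> by (auto simp: faces_H)
    then have "inj_on fst (set A)" "inj_on snd (set A)"
      using face_cycle_faceList by (auto simp: face_cycle_def distinct_map)
    moreover have "(a, b) \<in> set A \<and> (a, c) \<in> set A \<or> (b, a) \<in> set A \<and> (c, a) \<in> set A"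
      using that(2,3) by (auto simp: A(2) mirror_def split: if_splits)
    ultimately show ?thesis by (metis Pair_inject fst_conv inj_onD snd_conv)
  qed
  let ?T = "(\<lambda>A. mirror ` set A) ` {Tx, Ty, Tz}"
  have fst: "fst ` mirror ` set Tx = {Old (x, I), Old (x, y), Old (x, z)}"
    "fst ` mirror ` set Ty = {Old (y, I), Old (y, x), Old (y, z)}"
    "fst ` mirror ` set Tz = {Old (z, I), Old (z, x), Old (z, y)}"
    by (cases pos; simp add: mirror_def Tx_def Ty_def Tz_def insert_commute)+
  then have disj: "fst ` mirror ` set Tx \<inter> fst ` mirror ` set Ty = {}"
    "fst ` mirror ` set Ty \<inter> fst ` mirror ` set Tz = {}" "fst ` mirror ` set Tx \<inter> fst ` mirror ` set Tz = {}"
    by (simp_all add: neq')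
  then have "mirror ` set Tx \<noteq> mirror ` set Ty" "mirror ` set Ty \<noteq> mirror ` set Tz"
    "mirror ` set Tx \<noteq> mirror ` set Tz"
    using fst by (metis Int_absorb insert_not_empty)+
  then show "card ?T = 3" by simp
  show "?T \<subseteq> faces H rot" by (auto simp: faces_H faceList_def simp del: upt_Suc)
  have triple: "\<exists>p q r. mirror ` {(a, b), (b, c), (c, a)} = {(p, q), (q, r), (r, p)}" for a b c
  proof (cases pos)
    case True
    then have "mirror ` {(a, b), (b, c), (c, a)} = {(a, b), (b, c), (c, a)}" by (simp add: mirror_def)
    then show ?thesis by blast
  next
    case False
    then have "mirror ` {(a, b), (b, c), (c, a)} = {(a, c), (c, b), (b, a)}"
      by (auto simp: mirror_def)
    then show ?thesis by blast
  qed
  show "\<exists>p q r. t = {(p, q), (q, r), (r, p)}" if "t \<in> ?T" for t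
    using that triple by (auto simp only: Tx_def Ty_def Tz_def list.set image_insert insert_iff image_empty empty_iff)
  show "fst ` t \<inter> fst ` t' = {}" if "t \<in> ?T" "t' \<in> ?T" "t \<noteq> t'" for t t'
  proof -
    have "t = mirror ` set Tx \<or> t = mirror ` set Ty \<or> t = mirror ` set Tz"
      "t' = mirror ` set Tx \<or> t' = mirror ` set Ty \<or> t' = mirror ` set Tz"
      using that(1,2) by auto
    then show ?thesis using disj that(3) by (elim disjE) (simp_all only: Int_commute simp_thms)
  qed
qed

end

theorem theorem15:
  fixes v u w :: "nat \<times> nat" and s :: nat
  assumes "v \<in> pverts trunc_tetra"
    and "(v, u) \<in> parcs trunc_tetra" "(v, w) \<in> parcs trunc_tetra"
    and "u \<noteq> w" "(u, w) \<in> parcs trunc_tetra"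
  defines "H \<equiv> ladder_graph v u w s trunc_tetra"
    and "rot \<equiv> ladder_rot v u w s trunc_tetra_rot"
  shows "plane_graph H rot \<and> two_connected H \<and>
    hamiltonian H \<and> hamiltonian (dual_graph H rot) \<and>
    \<not> admits_rhombic_strip (face_lattice H rot) face_rank"
proof -
  obtain I x where v: "v = (I, x)" by (cases v)
  \<comment> \<open>An edge between different triangles lies on no 3-cycle, so the mutual adjacency
    of \<open>u\<close>, \<open>v\<close>, \<open>w\<close> puts all three into the triangle at
    \<open>I\<close>.\<close>
  obtain y where u: "u = (I, y)"
    using assms(1-5) v by (cases u; cases w) (auto simp: trunc_tetra_def)
  obtain z where w: "w = (I, z)"
    using assms(1-5) v by (cases u; cases w) (auto simp: trunc_tetra_def)
  interpret L: labelled_ladder I x y z s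
    using assms(1-5) by unfold_locales (auto simp: v u w trunc_tetra_def)
  have eq: "H = L.H" "rot = L.rot"
    by (simp_all add: H_def rot_def L.H_def L.rot_def v u w)
  show ?thesis
    unfolding eq
    using L.plane_graph_H L.two_connected_H L.hamiltonian_H L.hamiltonian_dual_H L.no_rhombic_strip_H
    by blast
qed

end
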